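(* Let $0<q<1$ and $a>0$. The polynomials $\tilde C_n^{(a)}(x;q)$, $n=0,1,2,\dots$, satisfy, for all integers $n,n'\ge 0$, the orthogonality relation $$\sum_{s=0}^\infty \sum_{\varepsilon=\pm 1} \frac{(-aq^2;q^2)_s\,q^s}{(q^2;q^2)_s}\, \tilde C_{n}^{(a)}(\varepsilon\sqrt{a}\,q^{s+1};q)\,\tilde C_{n'}^{(a)}(\varepsilon\sqrt{a}\,q^{s+1};q) = 2\,\frac{(-aq^3;q^2)_\infty}{(q;q^2)_\infty}\,\frac{(1+aq)\,a^{n}}{1+aq^{2n+1}}\, \frac{(q;q)_{n}}{(-aq;q)_{n}}\, q^{n(n+3)/2}\,\delta_{nn'} .$$ Moreover, the associated moment problem is determinate: up to a positive constant factor, the discrete measure on the left-hand side is the only positive measure on $\mathbb R$ with respect to which the polynomials $\tilde C_n^{(a)}(x;q)$ are orthogonal.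
   Context: Notation: $(b;q)_m=\prod_{j=0}^{m-1}(1-bq^j)$, $(b;q)_\infty=\prod_{j\ge 0}(1-bq^j)$, $(b_1,\dots,b_r;q)_m=\prod_i (b_i;q)_m$. The basic hypergeometric series is ${}_3\phi_2(\alpha,\beta,\gamma;\delta,\epsilon;q,z)=\sum_{m\ge 0}\frac{(\alpha,\beta,\gamma;q)_m}{(\delta,\epsilon,q;q)_m}z^m$; it terminates if one of the upper parameters is $q^{-n}$ with $n$ a nonnegative integer. For $a>0$ and $n\ge 0$ define $$\tilde C_n^{(a)}(x;q):=(-\mathrm i)^n\,{}_3\phi_2\left(q^{-n},\,-aq^{n+1},\,\mathrm i x;\ \mathrm i\sqrt a\,q,\,-\mathrm i\sqrt a\,q;\ q,q\right),$$ where $\mathrm i$ is the imaginary unit and $\sqrt a>0$. (Equivalently, $\tilde C_n^{(a)}(x;q)=(-\mathrm i)^nP_n(\mathrm i x;\mathrm i\sqrt a,\mathrm i\sqrt a,-\mathrm i\sqrt a;q)$, where $P_n(x;a,b,c;q)={}_3\phi_2(q^{-n},abq^{n+1},x;aq,cq;q,q)$ are the big $q$-Jacobi polynomials.) These are polynomials of degree $n$ in $x$ with real coefficients. *)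

theory Defs
  imports "HOL-Analysis.Analysis"
begin

definition qpoch :: "'a::comm_ring_1 \<Rightarrow> 'a \<Rightarrow> nat \<Rightarrow> 'a" where
  "qpoch b q m = (\<Prod>j<m. 1 - b * q ^ j)"

definition qpoch_inf :: "'a::real_normed_field \<Rightarrow> 'a \<Rightarrow> 'a" where
  "qpoch_inf b q = (\<Prod>j. 1 - b * q ^ j)"

definition phi32 ::
  "complex \<Rightarrow> complex \<Rightarrow> complex \<Rightarrow> complex \<Rightarrow> complex \<Rightarrow> complex \<Rightarrow> complex \<Rightarrow> complex" where
  "phi32 \<alpha> \<beta> \<gamma> \<delta> \<epsilon> q z =
     (\<Sum>m. qpoch \<alpha> q m * qpoch \<beta> q m * qpoch \<gamma> q m /
           (qpoch \<delta> q m * qpoch \<epsilon> q m * qpoch q q m) * z ^ m)"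

definition Ctilde :: "real \<Rightarrow> real \<Rightarrow> nat \<Rightarrow> complex \<Rightarrow> complex" where
  "Ctilde a q n x = (- \<i>) ^ n *
     phi32 (of_real (q powi (- int n))) (of_real (- a * q ^ (n + 1))) (\<i> * x)
           (\<i> * of_real (sqrt a) * of_real q) (- \<i> * of_real (sqrt a) * of_real q)
           (of_real q) (of_real q)"

definition node :: "real \<Rightarrow> real \<Rightarrow> nat \<Rightarrow> real \<Rightarrow> real" where
  "node a q s \<epsilon> = \<epsilon> * sqrt a * q ^ (s + 1)"

definition weight :: "real \<Rightarrow> real \<Rightarrow> nat \<Rightarrow> real" where
  "weight a q s = qpoch (- a * q ^ 2) (q ^ 2) s * q ^ s / qpoch (q ^ 2) (q ^ 2) s"

text \<open>The discrete measure with mass \<open>weight a q s\<close> at each of the points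
  \<open>node a q s 1\<close> and \<open>node a q s (-1)\<close>, as a measure on the Borel sets of the real line.\<close>

definition discrete_measure :: "real \<Rightarrow> real \<Rightarrow> real measure" where
  "discrete_measure a q =
     distr (density (count_space (UNIV \<times> {1, -1})) (\<lambda>(s, \<epsilon>). ennreal (weight a q s)))
           borel (\<lambda>(s, \<epsilon>). node a q s \<epsilon>)"

text \<open>A nonzero positive Borel measure for which all the pairwise products are integrable and
  distinct members are orthogonal.  The functions are complex-valued only for typing reasons: they
  are meant to be polynomials with real coefficients restricted to the real line, so no complex
  conjugation is needed.  Integrability has to be required, since the integral of a
  non-integrable function is 0 by convention.\<close>

definition orthogonality_measure :: "(nat \<Rightarrow> complex \<Rightarrow> complex) \<Rightarrow> real measure \<Rightarrow> bool" where
  "orthogonality_measure p M \<longleftrightarrow>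
     sets M = sets borel \<and> emeasure M UNIV \<noteq> 0 \<and>
     (\<forall>m n. integrable M (\<lambda>x. p m (of_real x) * p n (of_real x))) \<and>
     (\<forall>m n. m \<noteq> n \<longrightarrow> (\<integral>x. p m (of_real x) * p n (of_real x) \<partial>M) = 0)"

definition has_all_moments :: "real measure \<Rightarrow> bool" where
  "has_all_moments M \<longleftrightarrow> sets M = sets borel \<and> (\<forall>k::nat. integrable M (\<lambda>x. x ^ k))"

definition moment_determinate :: "real measure \<Rightarrow> bool" where
  "moment_determinate M \<longleftrightarrow> has_all_moments M \<and>
     (\<forall>N. has_all_moments N \<and> (\<forall>k::nat. (\<integral>x. x ^ k \<partial>N) = (\<integral>x. x ^ k \<partial>M)) \<longrightarrow> N = M)"

end

theory Submission
  imports Defs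
begin

text \<open>
  After the substitution \<open>x \<mapsto> \<i> x\<close> the measure becomes a functional \<open>L\<close> on polynomials, summing over
  \<open>x = \<plusminus>\<i> \<surd>a q\<^bsup>s+1\<^esup>\<close>.  Its weight satisfies a first-order recurrence, so summation by parts yields
  contiguous relations for \<open>L((x;q)\<^sub>m (-x;q)\<^sub>k)\<close>, which reduce it to \<open>L(1)\<close>, a \<open>q\<close>-binomial series:
  \<open>L((x;q)\<^sub>m (-x;q)\<^sub>k) = L(1) (-aq\<^sup>2;q\<^sup>2)\<^sub>m (-aq\<^sup>2;q\<^sup>2)\<^sub>k / (-aq\<^sup>2;q)\<^bsub>m+k\<^esub>\<close>.
  The factor depending on \<open>m\<close> alone cancels the denominator parameters of the \<open>\<^sub>3\<phi>\<^sub>2\<close>, so pairing it with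
  \<open>(-x;q)\<^sub>k\<close> leaves a \<open>\<^sub>2\<phi>\<^sub>1\<close> which the \<open>q\<close>-Chu-Vandermonde sum evaluates; it vanishes for \<open>k < n\<close>.
  The measure has compact support, hence is determined by its moments (Weierstrass approximation); and
  orthogonality of a sequence with one polynomial of each degree fixes all moments up to the total mass.
\<close>

subsection \<open>Shifted factorials and the \<open>q\<close>-Chu-Vandermonde sum\<close>

lemma qpoch_0 [simp]: "qpoch b q 0 = 1"
  by (simp add: qpoch_def)

lemma qpoch_Suc: "qpoch b q (Suc m) = qpoch b q m * (1 - b * q ^ m)"
  by (simp add: qpoch_def)

lemma qpoch_Suc_shift: "qpoch b q (Suc m) = (1 - b) * qpoch (b * q) q m"
  unfolding qpoch_def prod.lessThan_Suc_shift by (simp add: mult.assoc)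

lemma qpoch_add: "qpoch b q (m + n) = qpoch b q m * qpoch (b * q ^ m) q n"
  by (induction n) (simp_all add: qpoch_Suc power_add mult.assoc)

lemma qpoch_of_real: "qpoch (of_real b) (of_real q) m = (of_real (qpoch b q m) :: complex)"
  by (simp add: qpoch_def)

lemma poly_qpoch: "poly (qpoch b q m) x = qpoch (poly b x) (poly q x) m"
  by (induction m) (simp_all add: qpoch_Suc)

lemma qpoch_mult_uminus: "qpoch b q m * qpoch (- b) q m = qpoch (b ^ 2) (q ^ 2) m"
proof (induction m)
  case (Suc m)
  have e: "(1 - b * q ^ m) * (1 - - b * q ^ m) = 1 - b ^ 2 * (q ^ 2) ^ m"
    by (simp add: algebra_simps power2_eq_square power_mult_distrib)
  have "qpoch b q (Suc m) * qpoch (- b) q (Suc m)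
      = (qpoch b q m * qpoch (- b) q m) * ((1 - b * q ^ m) * (1 - - b * q ^ m))"
    unfolding qpoch_Suc by (simp only: mult_ac)
  then show ?case
    unfolding e Suc.IH by (simp only: qpoch_Suc)
qed simp

lemma qpoch_eq_0_iff: "qpoch b q m = 0 \<longleftrightarrow> (\<exists>j<m. b * q ^ j = 1)"
  for b q :: "'a::idom"
  by (auto simp: qpoch_def)

text \<open>The factor with index \<open>n\<close> is \<open>1 - q^-n q^n\<close>; this is what
  truncates the hypergeometric series.\<close>

lemma qpoch_neg_power_eq_0:
  fixes q :: "'a::field"
  assumes "q \<noteq> 0" "n < m"
  shows "qpoch (inverse q ^ n) q m = 0"
  using assms unfolding qpoch_eq_0_iff by (intro exI[of _ n]) (simp add: flip: power_mult_distrib)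

text \<open>Each factor \<open>1 - q^-i\<close> equals \<open>- q^-i (1 - q^i)\<close>, and the
  exponents add up to \<open>n(n+1)/2\<close>. The power stays on the left so that no negative
  triangular exponent arises.\<close>

lemma qpoch_neg_power_same:
  fixes q :: "'a::field"
  assumes q: "q \<noteq> 0"
  shows "qpoch (inverse q ^ n) q n * q ^ (n * (n + 1) div 2) = (- 1) ^ n * qpoch q q n"
proof (induction n)
  case (Suc n)
  have 1: "qpoch (inverse q ^ Suc n) q (Suc n) = (1 - inverse q ^ Suc n) * qpoch (inverse q ^ n) q n"
    unfolding qpoch_Suc_shift using q by (simp add: field_simps)
  have 2: "Suc n * (Suc n + 1) div 2 = n * (n + 1) div 2 + Suc n"
    by simp
  have 3: "(1 - inverse q ^ Suc n) * q ^ Suc n = - (1 - q * q ^ n)"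
    using q by (simp add: field_simps)
  have "qpoch (inverse q ^ Suc n) q (Suc n) * q ^ (Suc n * (Suc n + 1) div 2)
     = ((1 - inverse q ^ Suc n) * q ^ Suc n) * (qpoch (inverse q ^ n) q n * q ^ (n * (n + 1) div 2))"
    unfolding 1 2 power_add by (simp only: mult_ac)
  also have "\<dots> = (- 1) ^ Suc n * qpoch q q (Suc n)"
    unfolding 3 Suc.IH by (simp add: qpoch_Suc algebra_simps)
  finally show ?case .
qed simp

text \<open>Writing \<open>\<Prod>j<n. b - c * q ^ j\<close> for \<open>b ^ n * qpoch (c / b) q n\<close> avoids the assumption
  \<open>b \<noteq> 0\<close>.\<close>

lemma q_Chu_Vandermonde:
  fixes q b c :: "'a::field"
  assumes q0: "q \<noteq> 0" and q: "\<And>j. q ^ Suc j \<noteq> 1" and c: "\<And>j. c * q ^ j \<noteq> 1"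
  shows "(\<Sum>m\<le>n. qpoch (inverse q ^ n) q m * qpoch b q m / (qpoch q q m * qpoch c q m) * q ^ m)
           = (\<Prod>j<n. b - c * q ^ j) / qpoch c q n"
  using c
proof (induction n arbitrary: b c)
  case (Suc n)
  define t where "t = (\<lambda>n b c m. qpoch (inverse q ^ n) q m * qpoch b q m /
                          (qpoch q q m * qpoch c q m) * q ^ m)"
  have qq: "qpoch q q m \<noteq> 0" for m
    using q by (auto simp: qpoch_eq_0_iff)
  have cc: "qpoch c q m \<noteq> 0" for m
    using Suc.prems by (auto simp: qpoch_eq_0_iff)
  have c1: "1 - c \<noteq> 0" using Suc.prems[of 0] by simp
  have cq: "c * q * q ^ j \<noteq> 1" for j
    using Suc.prems[of "Suc j"] by (simp add: mult.assoc)
  have ccq: "qpoch (c * q) q m \<noteq> 0" for m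
    using cq by (auto simp: qpoch_eq_0_iff)
  \<comment> \<open>A Pascal-type rule: raising \<open>n\<close> subtracts a multiple of the term
    with \<open>b\<close>, \<open>c\<close> replaced by \<open>bq\<close>, \<open>cq\<close> and the
    index lowered. This is why the induction keeps \<open>b\<close> and \<open>c\<close>
    arbitrary.\<close>
  have diff: "t (Suc n) b c (Suc m) = t n b c (Suc m)
        - inverse q ^ n * (1 - b) / (1 - c) * t n (b * q) (c * q) m" for m
  proof -
    define X where "X = qpoch (inverse q ^ n) q m"
    have "qpoch (inverse q ^ Suc n) q (Suc m) = (1 - inverse q ^ Suc n) * X"
      unfolding qpoch_Suc_shift X_def using q0 by (simp add: field_simps)
    moreover have "qpoch (inverse q ^ n) q (Suc m) = X * (1 - inverse q ^ n * q ^ m)"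
      by (simp add: qpoch_Suc X_def)
    moreover have "(1 - inverse q * i) * X = X * (1 - i * y) - i * inverse q * (1 - q * y) * X" for i y
      using q0 by (simp add: field_simps)
    ultimately have e: "qpoch (inverse q ^ Suc n) q (Suc m) =
        qpoch (inverse q ^ n) q (Suc m) - inverse q ^ n * inverse q * (1 - q * q ^ m) * X"
      by (simp del: power_inverse)
    have arith: "(A - i * inverse q * u * X) * (v * B) / (D * u * (w * C)) * (q * y)
        = A * (v * B) / (D * u * (w * C)) * (q * y) - i * v / w * (X * B / (D * C) * y)"
      if "u \<noteq> 0" "w \<noteq> 0" "D \<noteq> 0" "C \<noteq> 0" for A i u v w B C D y :: 'a
    proof -
      have "i * inverse q * u * X * (v * B) / (D * u * (w * C)) * (q * y)
          = i * v / w * (X * B / (D * C) * y)"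
        using that q0 by (simp add: divide_simps)
      then show ?thesis by (simp only: left_diff_distrib diff_divide_distrib)
    qed
    have u: "1 - q * q ^ m \<noteq> 0" using q[of m] by simp
    show ?thesis
      unfolding t_def e qpoch_Suc_shift[of b] qpoch_Suc_shift[of c] qpoch_Suc[of q] power_Suc[of q m]
        X_def[symmetric]
      by (rule arith[OF u c1 qq ccq])
  qed
  \<comment> \<open>The shifted sum reaches index \<open>Suc n\<close>, one beyond the end of the
    series for \<open>n\<close>; the extra term vanishes.\<close>
  have last: "t n b c (Suc n) = 0"
    unfolding t_def using qpoch_neg_power_eq_0[OF q0, of n "Suc n"] by simp
  have t0: "t k b c 0 = 1" for k by (simp add: t_def)
  have "(\<Sum>m\<le>Suc n. t (Suc n) b c m) = 1 + (\<Sum>m\<le>n. t (Suc n) b c (Suc m))"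
    unfolding sum.atMost_Suc_shift t0 ..
  also have "\<dots> = (1 + (\<Sum>m\<le>n. t n b c (Suc m)))
        - inverse q ^ n * (1 - b) / (1 - c) * (\<Sum>m\<le>n. t n (b * q) (c * q) m)"
    unfolding diff by (simp add: sum_subtractf sum_distrib_left)
  also have "1 + (\<Sum>m\<le>n. t n b c (Suc m)) = (\<Sum>m\<le>n. t n b c m)"
    using sum.atMost_Suc_shift[of "t n b c" n] last t0 by (simp del: sum.lessThan_Suc_shift)
  also have "(\<Sum>m\<le>n. t n b c m) = (\<Prod>j<n. b - c * q ^ j) / qpoch c q n"
    unfolding t_def by (rule Suc.IH) (use Suc.prems in auto)
  also have "(\<Sum>m\<le>n. t n (b * q) (c * q) m) = (\<Prod>j<n. b * q - c * q * q ^ j) / qpoch (c * q) q n"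
    unfolding t_def by (rule Suc.IH) (use cq in auto)
  also have "(\<Prod>j<n. b * q - c * q * q ^ j) = (\<Prod>j<n. b - c * q ^ j) * q ^ n"
  proof -
    have "(\<Prod>j<n. b * q - c * q * q ^ j) = (\<Prod>j<n. (b - c * q ^ j) * q)"
      by (intro prod.cong refl) (simp add: algebra_simps)
    then show ?thesis by (simp add: prod.distrib)
  qed
  also have "inverse q ^ n * (1 - b) / (1 - c) *
        ((\<Prod>j<n. b - c * q ^ j) * q ^ n / qpoch (c * q) q n)
      = (\<Prod>j<n. b - c * q ^ j) * (1 - b) / ((1 - c) * qpoch (c * q) q n)"
    using q0 c1 ccq[of n] by (simp add: field_simps)
  also have "(1 - c) * qpoch (c * q) q n = qpoch c q n * (1 - c * q ^ n)"
    using qpoch_Suc_shift[of c q n] qpoch_Suc[of c q n] by simp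
  also have "(\<Prod>j<n. b - c * q ^ j) / qpoch c q n -
        (\<Prod>j<n. b - c * q ^ j) * (1 - b) / (qpoch c q n * (1 - c * q ^ n))
      = (\<Prod>j<Suc n. b - c * q ^ j) / qpoch c q (Suc n)"
  proof -
    have "P / C - P * (1 - b) / (C * (1 - y)) = P * (b - y) / (C * (1 - y))"
      if "C \<noteq> 0" "1 - y \<noteq> 0" for P C y
      using that by (simp add: divide_simps) (simp add: algebra_simps)
    then show ?thesis using cc[of n] Suc.prems[of n] by (simp add: qpoch_Suc)
  qed
  finally show ?case unfolding t_def .
qed simp

subsection \<open>The \<open>q\<close>-binomial theorem\<close>

text \<open>The deviations of the factors from 1 are absolutely summable, so the product converges;
  as no factor is 0, neither is the limit.\<close>

lemma qpoch_inf_LIMSEQ: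
  fixes b q :: real
  assumes q: "0 < q" "q < 1" and b: "\<And>j. b * q ^ j \<noteq> 1"
  shows "(\<lambda>m. qpoch b q m) \<longlonglongrightarrow> qpoch_inf b q" and "qpoch_inf b q \<noteq> 0"
proof -
  have "summable (\<lambda>j. norm (- (b * q ^ j)))"
    using q by (simp add: abs_mult summable_mult summable_geometric)
  then have "abs_convergent_prod (\<lambda>j. 1 + - (b * q ^ j))"
    by (subst abs_convergent_prod_conv_summable) auto
  then have cp: "convergent_prod (\<lambda>j. 1 - b * q ^ j)"
    by (simp add: abs_convergent_prod_imp_convergent_prod)
  show "(\<lambda>m. qpoch b q m) \<longlonglongrightarrow> qpoch_inf b q"
    unfolding qpoch_def qpoch_inf_def
    using convergent_prod_LIMSEQ[OF cp] LIMSEQ_lessThan_iff_atMost by auto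
  show "qpoch_inf b q \<noteq> 0"
    unfolding qpoch_inf_def using prodinf_nonzero[OF cp] b by auto
qed

text \<open>The sum satisfies \<open>(1 - y) F(y) = (1 - b y) F(p y)\<close>. Iterating along
  \<open>p^n z\<close>, which tends to 0, and using continuity with \<open>F(0) = 1\<close> produces
  the quotient of infinite products. The sign of \<open>b\<close> makes all coefficients positive
  and keeps the factors of the numerator nonzero.\<close>

lemma q_binomial_theorem:
  fixes b p z :: real
  assumes p: "0 < p" "p < 1" and z: "0 < z" "z < 1" and b: "b \<le> 0"
  shows "(\<lambda>s. qpoch b p s / qpoch p p s * z ^ s) sums (qpoch_inf (b * z) p / qpoch_inf z p)"
proof -
  define c where "c = (\<lambda>s. qpoch b p s / qpoch p p s)"
  have pp: "1 - p * p ^ s > 0" for s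
    using power_strict_decreasing[of 0 "Suc s" p] p by simp
  have rec: "c (Suc s) * (1 - p * p ^ s) = c s * (1 - b * p ^ s)" for s
    unfolding c_def qpoch_Suc using pp[of s] by simp
  have c0: "c 0 = 1" by (simp add: c_def)
  have cpos: "c s > 0" for s
  proof (induction s)
    case (Suc s)
    have "c s * (1 - b * p ^ s) > 0"
      using Suc b p by (intro mult_pos_pos) (auto simp: mult_le_0_iff intro: order.strict_trans1[of _ 0])
    then show ?case using rec[of s] pp[of s] by (metis zero_less_mult_pos2)
  qed (simp add: c0)
  have sumc: "summable (\<lambda>s. c s * y ^ s)" if y: "0 \<le> y" "y < 1" for y
  proof -
    \<comment> \<open>The coefficient ratio tends to 1, so any number strictly between
      \<open>y\<close> and 1 eventually bounds the ratio of terms; the midpoint serves.\<close>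
    define r where "r = (1 + y) / 2"
    have r: "y < r" "r < 1" using y by (auto simp: r_def)
    have "(\<lambda>s. (1 - b * p ^ s) / (1 - p * p ^ s) * y) \<longlonglongrightarrow> (1 - b * 0) / (1 - p * 0) * y"
      using p by (intro tendsto_intros LIMSEQ_power_zero) auto
    then have "eventually (\<lambda>s. (1 - b * p ^ s) / (1 - p * p ^ s) * y < r) sequentially"
      using r by (intro order_tendstoD(2)) auto
    then obtain N where N: "\<And>s. s \<ge> N \<Longrightarrow> (1 - b * p ^ s) / (1 - p * p ^ s) * y < r"
      by (auto simp: eventually_sequentially)
    show ?thesis
    proof (rule summable_ratio_test[of r N])
      fix s assume s: "s \<ge> N"
      have e: "c (Suc s) = (1 - b * p ^ s) / (1 - p * p ^ s) * c s"
        using rec[of s] pp[of s] by (simp add: field_simps)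
      have "c (Suc s) * y ^ Suc s = ((1 - b * p ^ s) / (1 - p * p ^ s) * y) * (c s * y ^ s)"
        unfolding e by simp
      also have "\<dots> \<le> r * (c s * y ^ s)"
        using N[OF s] cpos[of s] y by (intro mult_right_mono) auto
      finally show "norm (c (Suc s) * y ^ Suc s) \<le> r * norm (c s * y ^ s)"
        using cpos[of s] cpos[of "Suc s"] y by (simp add: abs_mult)
    qed (use r in auto)
  qed
  define F where "F = (\<lambda>y. \<Sum>s. c s * y ^ s)"
  have Fs: "(\<lambda>s. c s * y ^ s) sums F y" if "0 \<le> y" "y < 1" for y
    unfolding F_def using sumc[OF that] by (rule summable_sums)
  have feq: "(1 - y) * F y = (1 - b * y) * F (p * y)" if y: "0 \<le> y" "y < 1" for y
  proof -
    have py: "0 \<le> p * y" "p * y < 1"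
      using y p by (auto intro: order.strict_trans1[OF mult_left_le_one_le])
    have A: "(\<lambda>s. c s * y ^ s - c s * (p * y) ^ s) sums (F y - F (p * y))"
      by (intro sums_diff Fs y py)
    \<comment> \<open>The term of index 0 is \<open>c 0 - c 0\<close>, so shifting the index leaves
      the sum unchanged.\<close>
    have B: "(\<lambda>s. c (Suc s) * y ^ Suc s - c (Suc s) * (p * y) ^ Suc s) sums (F y - F (p * y))"
      using A by (subst sums_Suc_iff) simp
    have C: "(\<lambda>s. y * (c s * y ^ s) - b * y * (c s * (p * y) ^ s)) sums (y * F y - b * y * F (p * y))"
      by (intro sums_diff sums_mult Fs y py)
    have "c (Suc s) * y ^ Suc s - c (Suc s) * (p * y) ^ Suc s
        = y * (c s * y ^ s) - b * y * (c s * (p * y) ^ s)" for s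
    proof -
      have "c (Suc s) * y ^ Suc s - c (Suc s) * (p * y) ^ Suc s
          = (c (Suc s) * (1 - p * p ^ s)) * y ^ Suc s"
        by (simp add: algebra_simps power_mult_distrib)
      then show ?thesis unfolding rec by (simp add: algebra_simps power_mult_distrib)
    qed
    with B C have "F y - F (p * y) = y * F y - b * y * F (p * y)"
      using sums_unique2 by fastforce
    then show ?thesis by (simp add: algebra_simps)
  qed
  have iter: "qpoch z p n * F z = qpoch (b * z) p n * F (p ^ n * z)" for n
  proof (induction n)
    case (Suc n)
    have y: "0 \<le> p ^ n * z" "p ^ n * z < 1"
      using z p by (auto intro: order.strict_trans1[OF mult_left_le_one_le] simp: power_le_one)
    have "qpoch z p (Suc n) * F z = (1 - p ^ n * z) * (qpoch z p n * F z)"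
      by (simp add: qpoch_Suc algebra_simps)
    also have "\<dots> = qpoch (b * z) p n * ((1 - p ^ n * z) * F (p ^ n * z))"
      unfolding Suc.IH by simp
    also have "\<dots> = qpoch (b * z) p (Suc n) * F (p ^ Suc n * z)"
      unfolding feq[OF y] by (simp add: qpoch_Suc algebra_simps)
    finally show ?case .
  qed simp
  have "isCont F 0"
    unfolding F_def using isCont_powser[of c "1/2" 0] sumc[of "1/2"] by simp
  moreover have "(\<lambda>n. p ^ n * z) \<longlonglongrightarrow> 0 * z"
    using p by (intro tendsto_intros LIMSEQ_power_zero) auto
  ultimately have "(\<lambda>n. F (p ^ n * z)) \<longlonglongrightarrow> F 0"
    by (intro isCont_tendsto_compose[of 0 F]) auto
  moreover have "F 0 = 1"
    unfolding F_def using powser_zero[of c] c0 by simp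
  ultimately have F1: "(\<lambda>n. F (p ^ n * z)) \<longlonglongrightarrow> 1" by simp
  have zne: "z * p ^ j \<noteq> 1" for j
    using z p mult_right_le_one_le[of z "p ^ j"] power_le_one[of p j] by (smt (verit) zero_le_power)
  have bne: "b * z * p ^ j \<noteq> 1" for j
  proof -
    have "b * z * p ^ j \<le> 0" using b z p by (simp add: mult_le_0_iff)
    then show ?thesis by linarith
  qed
  have "(\<lambda>n. qpoch z p n * F z) \<longlonglongrightarrow> qpoch_inf z p * F z"
    by (intro tendsto_intros qpoch_inf_LIMSEQ p zne)
  moreover have "(\<lambda>n. qpoch z p n * F z) \<longlonglongrightarrow> qpoch_inf (b * z) p * 1"
    unfolding iter by (intro tendsto_intros qpoch_inf_LIMSEQ p bne F1)
  ultimately have "qpoch_inf z p * F z = qpoch_inf (b * z) p"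
    using LIMSEQ_unique by fastforce
  then have "F z = qpoch_inf (b * z) p / qpoch_inf z p"
    using qpoch_inf_LIMSEQ(2)[OF p zne] by (simp add: field_simps)
  then show ?thesis using Fs[of z] z by (simp add: c_def)
qed

subsection \<open>The orthogonality functional\<close>

text \<open>Every factor \<open>1 - c q^j X\<close> contributes \<open>- c q^j\<close> to the
  leading coefficient. Both claims go through one induction, since the step for the leading
  coefficient uses the vanishing of the next one.\<close>

lemma coeff_qpoch_linear:
  fixes c q :: "'a::idom"
  shows "coeff (qpoch [:0, c:] [:q:] m) m = (- c) ^ m * q ^ (m * (m - 1) div 2)"
    and "i > m \<Longrightarrow> coeff (qpoch [:0, c:] [:q:] m) i = 0"
proof (induction m arbitrary: i)
  case (Suc m)
  have "[:0, c:] * [:q:] ^ m = [:0, c * q ^ m:]"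
    by (induction m) (simp_all add: one_pCons algebra_simps)
  then have e: "qpoch [:0, c:] [:q:] (Suc m) = qpoch [:0, c:] [:q:] m * [:1, - c * q ^ m:]"
    unfolding qpoch_Suc by (simp add: one_pCons)
  {
    case 1
    have "Suc m * (Suc m - 1) div 2 = m * (m - 1) div 2 + m"
      by (cases m) auto
    then show ?case
      using Suc.IH(2)[of "Suc m"] Suc.IH(1) unfolding e by (simp add: power_add)
  next
    case 2
    then show ?case using Suc.IH(2)[of i] Suc.IH(2)[of "i - 1"]
      unfolding e by (cases i) auto
  }
qed auto

text \<open>Subtract the multiple of the top basis element that removes the highest coefficient, and
  recurse. Bounding the degree through coefficients makes \<open>n = 0\<close> mean exactly the zero
  polynomial.\<close>

lemma triangular_poly_span:
  fixes P :: "nat \<Rightarrow> 'a::field poly"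
  assumes top: "\<And>k. coeff (P k) k \<noteq> 0" and deg: "\<And>k i. i > k \<Longrightarrow> coeff (P k) i = 0"
    and p: "\<And>i. i \<ge> n \<Longrightarrow> coeff p i = 0"
  shows "\<exists>\<alpha>. p = (\<Sum>k<n. smult (\<alpha> k) (P k))"
  using p
proof (induction n arbitrary: p)
  case 0
  then show ?case by (auto simp: poly_eq_iff)
next
  case (Suc n)
  define c where "c = coeff p n / coeff (P n) n"
  have "coeff (p - smult c (P n)) i = 0" if "i \<ge> n" for i
    using that Suc.prems[of i] top[of n] deg[of n i] by (cases "i = n") (auto simp: c_def)
  from Suc.IH[OF this] obtain \<alpha> where "p - smult c (P n) = (\<Sum>k<n. smult (\<alpha> k) (P k))"
    by blast
  then have "p = (\<Sum>k<n. smult ((\<alpha>(n := c)) k) (P k)) + smult c (P n)"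
    by (simp add: algebra_simps)
  then show ?case by (intro exI[of _ "\<alpha>(n := c)"]) simp
qed

section \<open>Nodes, weight and the functional\<close>

context
  fixes a q :: real
  assumes q: "0 < q" "q < 1" and a: "a > 0"
begin

text \<open>The positive node rotated by \<open>\<i>\<close>; the negative one becomes
  \<open>- xnode s\<close>.\<close>

definition xnode :: "nat \<Rightarrow> complex" where
  "xnode s = \<i> * of_real (sqrt a * q ^ (s + 1))"

text \<open>The functional \<open>L\<close>. Both signs share one term, as the telescoping argument
  requires.\<close>

definition qfun :: "complex poly \<Rightarrow> complex" where
  "qfun p = (\<Sum>s. of_real (weight a q s) * (poly p (xnode s) + poly p (- xnode s)))"

lemma q_power_neq_1: "q ^ Suc j \<noteq> 1"
  using power_strict_decreasing[of 0 "Suc j" q] q by simp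

lemma q_power_less_1: "q ^ Suc j < 1"
  using power_strict_decreasing[of 0 "Suc j" q] q by simp

lemma qpoch_neg_pos: "c \<ge> 0 \<Longrightarrow> r > 0 \<Longrightarrow> qpoch (- c) r m > 0" for c r :: real
  unfolding qpoch_def by (intro prod_pos) (auto intro: add_pos_nonneg)

lemma qpoch_q_pos: "qpoch q q m > 0"
  unfolding qpoch_def by (intro prod_pos) (use q_power_less_1 in auto)

lemma qpoch_q2_pos: "qpoch (q ^ 2) (q ^ 2) m > 0"
  unfolding qpoch_def
proof (intro prod_pos ballI)
  fix j show "0 < 1 - q\<^sup>2 * (q\<^sup>2) ^ j"
    using q_power_less_1[of "2 * j + 1"] by (simp add: power_mult power2_eq_square)
qed

lemma weight_pos: "weight a q s > 0"
  unfolding weight_def using qpoch_neg_pos[of "a * q ^ 2" "q ^ 2" s] qpoch_q2_pos[of s] a q by simp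

text \<open>The \<open>q\<close>-binomial theorem with base \<open>q^2\<close>,
  \<open>b = - a q^2\<close> and \<open>z = q\<close>.\<close>

lemma weight_sums:
  "weight a q sums (qpoch_inf (- a * q ^ 3) (q ^ 2) / qpoch_inf q (q ^ 2))"
proof -
  have "(\<lambda>s. qpoch (- a * q ^ 2) (q ^ 2) s / qpoch (q ^ 2) (q ^ 2) s * q ^ s) sums
          (qpoch_inf (- a * q ^ 2 * q) (q ^ 2) / qpoch_inf q (q ^ 2))"
    by (rule q_binomial_theorem) (use q a in \<open>auto simp: power_less_one_iff\<close>)
  also have "- a * q ^ 2 * q = - a * q ^ 3" by (simp add: power2_eq_square power3_eq_cube)
  finally show ?thesis by (simp add: weight_def[abs_def])
qed

lemma summable_weight: "summable (weight a q)"
  using weight_sums by (rule sums_summable)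

text \<open>A discrete Pearson equation: with \<open>x = xnode s\<close> and
  \<open>x' = xnode (Suc s)\<close> the factors are \<open>1 + x'^2 / (a q^2)\<close> on the left
  and \<open>1 - x^2\<close> on the right, both even polynomials in the node.\<close>

lemma weight_recurrence:
  "weight a q (Suc s) * (1 - q ^ (2 * s + 2)) = q * weight a q s * (1 + a * q ^ (2 * s + 2))"
proof -
  have e: "q ^ 2 * (q ^ 2) ^ s = q ^ (2 * s + 2)"
    by (simp add: power_mult power_add power2_eq_square)
  then have "1 - q ^ 2 * (q ^ 2) ^ s \<noteq> 0" using q_power_neq_1[of "2 * s + 1"] by simp
  moreover have "1 - (- a * q ^ 2) * (q ^ 2) ^ s = 1 + a * q ^ (2 * s + 2)"
    using e by (simp add: mult.assoc)
  ultimately show ?thesis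
    using qpoch_q2_pos[of s] by (simp add: weight_def qpoch_Suc e)
qed

lemma norm_xnode_le: "norm (xnode s) \<le> sqrt a"
  using a q power_le_one[of q "s + 1"]
  by (simp add: xnode_def norm_mult norm_power abs_mult mult_left_le)

lemma poly_xnode_bounded:
  obtains B where "\<And>s. norm (poly p (xnode s)) \<le> B" "\<And>s. norm (poly p (- xnode s)) \<le> B"
proof -
  have "compact (poly p ` cball 0 (sqrt a))"
    by (intro compact_continuous_image continuous_intros) auto
  then obtain B where "\<And>x. x \<in> cball 0 (sqrt a) \<Longrightarrow> norm (poly p x) \<le> B"
    by (metis compact_imp_bounded bounded_iff image_eqI)
  then show ?thesis by (intro that) (use norm_xnode_le in auto)
qed

text \<open>Polynomials are bounded on the nodes, which lie in a fixed disc, and the weights are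
  summable.\<close>

lemma qfun_sums:
  "(\<lambda>s. of_real (weight a q s) * (poly p (xnode s) + poly p (- xnode s))) sums qfun p"
  unfolding qfun_def
proof (rule summable_sums)
  obtain B where B: "\<And>s. norm (poly p (xnode s)) \<le> B" "\<And>s. norm (poly p (- xnode s)) \<le> B"
    by (rule poly_xnode_bounded[of p]) blast
  show "summable (\<lambda>s. of_real (weight a q s) * (poly p (xnode s) + poly p (- xnode s)))"
  proof (rule summable_comparison_test)
    show "summable (\<lambda>s. weight a q s * (B + B))"
      by (intro summable_mult2 summable_weight)
    have "norm (of_real (weight a q s) * (poly p (xnode s) + poly p (- xnode s)))
            \<le> weight a q s * (B + B)" for s
      unfolding norm_mult using weight_pos[of s] B[of s]
      by (intro mult_mono order.trans[OF norm_triangle_ineq]) auto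
    then show "\<exists>N. \<forall>s\<ge>N. norm (of_real (weight a q s) * (poly p (xnode s) + poly p (- xnode s)))
            \<le> weight a q s * (B + B)" by blast
  qed
qed

lemma qfun_add: "qfun (p + r) = qfun p + qfun r"
  using sums_add[OF qfun_sums[of p] qfun_sums[of r]] qfun_sums[of "p + r"]
  by (simp add: algebra_simps sums_unique2)

lemma qfun_smult: "qfun (smult c p) = c * qfun p"
  using sums_mult[OF qfun_sums[of p], of c] qfun_sums[of "smult c p"]
  by (simp add: algebra_simps sums_unique2)

lemma qfun_0: "qfun 0 = 0"
  by (simp add: qfun_def)

lemma qfun_sum: "qfun (\<Sum>k\<in>A. f k) = (\<Sum>k\<in>A. qfun (f k))"
  by (induction A rule: infinite_finite_induct) (auto simp: qfun_0 qfun_add)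

lemma qfun_1: "qfun 1 = of_real (2 * (qpoch_inf (- a * q ^ 3) (q ^ 2) / qpoch_inf q (q ^ 2)))"
proof -
  have "(\<lambda>s. of_real (2 * weight a q s) :: complex) sums
          of_real (2 * (qpoch_inf (- a * q ^ 3) (q ^ 2) / qpoch_inf q (q ^ 2)))"
    by (intro sums_of_real sums_mult weight_sums)
  then show ?thesis
    using qfun_sums[of 1] by (simp add: mult.commute sums_unique2)
qed


section \<open>The two shifted-factorial bases and their contiguous relations\<close>

abbreviation (input) Q :: complex where "Q \<equiv> of_real q"
abbreviation (input) A :: complex where "A \<equiv> of_real a"

abbreviation pos_base :: "nat \<Rightarrow> complex poly" where
  "pos_base m \<equiv> qpoch [:0, 1:] [:Q:] m"

abbreviation neg_base :: "nat \<Rightarrow> complex poly" where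
  "neg_base k \<equiv> qpoch [:0, -1:] [:Q:] k"

lemma xnode_squared: "xnode s ^ 2 = - A * Q ^ (2 * s + 2)"
proof -
  have "xnode s ^ 2 = - of_real (sqrt a ^ 2 * (q ^ (s + 1)) ^ 2)"
    by (simp add: xnode_def power_mult_distrib)
  also have "sqrt a ^ 2 = a" using a by simp
  also have "(q ^ (s + 1)) ^ 2 = q ^ (2 * s + 2)"
    by (simp add: power_mult power_add power2_eq_square power_mult_distrib)
  finally show ?thesis by simp
qed

lemma xnode_nonzero: "xnode s \<noteq> 0"
  using a q by (simp add: xnode_def)

lemma xnode_Suc: "xnode (Suc s) = Q * xnode s"
  by (simp add: xnode_def)

text \<open>Summation by parts: the weight satisfies a first-order recurrence, so the sum over \<open>s\<close>
  telescopes.  Neither half of the sum has a vanishing boundary term, but at infinity the two cancel.\<close>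

lemma qfun_eq_0_telescope:
  fixes F G T :: "complex poly"
  assumes FG: "\<And>x. poly G (Q * x) = poly F x"
    and T: "\<And>x. A * Q ^ 2 * x * poly T x
              = (A * Q ^ 2 + x ^ 2) * poly G x - A * Q ^ 2 * (1 - x ^ 2) * poly F x"
  shows "qfun T = 0"
proof -
  define w where "w = (\<lambda>s. of_real (weight a q s) :: complex)"
  \<comment> \<open>The boundary term of the summation by parts. Only the odd part of
    \<open>F\<close> enters, since opposite nodes carry the same weight.\<close>
  define H where "H = (\<lambda>s. w s * (1 - xnode s ^ 2) * (poly F (xnode s) - poly F (- xnode s)) / xnode s)"
  have AQ: "A * Q ^ 2 \<noteq> 0" using a q by simp
  have Q0: "Q \<noteq> 0" using q by simp
  have partial: "(\<Sum>s<Suc N. w s * (poly T (xnode s) + poly T (- xnode s))) = - H N" for N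
  proof (induction N)
    case 0
    \<comment> \<open>The coefficient of \<open>G\<close> vanishes at the first node, so there is no
      lower boundary term.\<close>
    have "A * Q ^ 2 + xnode 0 ^ 2 = 0" unfolding xnode_squared by (simp add: power2_eq_square)
    then have "A * Q ^ 2 * (xnode 0 * (poly T (xnode 0) + poly T (- xnode 0)))
        = A * Q ^ 2 * (- (1 - xnode 0 ^ 2) * (poly F (xnode 0) - poly F (- xnode 0)))"
      using T[of "xnode 0"] T[of "- xnode 0"] by (simp add: algebra_simps)
    then have "xnode 0 * (poly T (xnode 0) + poly T (- xnode 0))
        = - (1 - xnode 0 ^ 2) * (poly F (xnode 0) - poly F (- xnode 0))"
      using AQ by (simp only: mult_cancel_left) simp
    then have "xnode 0 * (poly T (xnode 0) + poly T (- xnode 0)) / xnode 0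
        = - ((1 - xnode 0 ^ 2) * (poly F (xnode 0) - poly F (- xnode 0)) / xnode 0)"
      by (simp only: minus_divide_left minus_mult_left)
    then have "poly T (xnode 0) + poly T (- xnode 0)
        = - ((1 - xnode 0 ^ 2) * (poly F (xnode 0) - poly F (- xnode 0)) / xnode 0)"
      using xnode_nonzero[of 0] by (simp only: nonzero_mult_div_cancel_left not_False_eq_True)
    then show ?case by (simp add: H_def mult.assoc del: minus_diff_eq)
  next
    case (Suc N)
    define x y where "x = xnode (Suc N)" and "y = xnode N"
    have xy: "x = Q * y" by (simp add: x_def y_def xnode_Suc)
    have x0: "x \<noteq> 0" and y0: "y \<noteq> 0" by (auto simp: x_def y_def xnode_nonzero)
    have "of_real (weight a q (Suc N) * (1 - q ^ (2 * N + 2))) =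
          (of_real (q * weight a q N * (1 + a * q ^ (2 * N + 2))) :: complex)"
      unfolding weight_recurrence ..
    then have wrec: "w (Suc N) * (1 - Q ^ (2 * N + 2)) = Q * w N * (1 - y ^ 2)"
      unfolding y_def xnode_squared by (simp add: w_def)
    \<comment> \<open>At this node the coefficient of \<open>G\<close> carries exactly the factor
      that the weight recurrence converts to the preceding node.\<close>
    have AQx: "A * Q ^ 2 + x ^ 2 = A * Q ^ 2 * (1 - Q ^ (2 * N + 2))"
      unfolding x_def xnode_squared by (simp add: algebra_simps power2_eq_square)
    have G: "poly G x = poly F y" "poly G (- x) = poly F (- y)"
      using FG[of y] FG[of "- y"] by (auto simp: xy)
    have "A * Q ^ 2 * (x * (poly T x + poly T (- x)))
        = A * Q ^ 2 * x * poly T x - A * Q ^ 2 * (- x) * poly T (- x)"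
      by (simp add: algebra_simps)
    also have "\<dots> = A * Q ^ 2 * ((1 - Q ^ (2 * N + 2)) * (poly F y - poly F (- y))
             - (1 - x ^ 2) * (poly F x - poly F (- x)))"
      unfolding T power2_minus AQx G by (simp add: algebra_simps)
    finally have "x * (poly T x + poly T (- x)) = (1 - Q ^ (2 * N + 2)) * (poly F y - poly F (- y))
             - (1 - x ^ 2) * (poly F x - poly F (- x))"
      using AQ by (simp only: mult_cancel_left) simp
    then have step: "w (Suc N) * (x * (poly T x + poly T (- x)))
       = w (Suc N) * ((1 - Q ^ (2 * N + 2)) * (poly F y - poly F (- y))
             - (1 - x ^ 2) * (poly F x - poly F (- x)))"
      by (simp only:)
    have "x * (w (Suc N) * (poly T x + poly T (- x)))
       = (w (Suc N) * (1 - Q ^ (2 * N + 2))) * (poly F y - poly F (- y))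
          - w (Suc N) * (1 - x ^ 2) * (poly F x - poly F (- x))"
    proof -
      have "x * (w' * S) = w' * u * d - w' * v * e" if "w' * (x * S) = w' * (u * d - v * e)"
        for w' S u d v e :: complex
        using that by (simp add: algebra_simps)
      then show ?thesis using step by blast
    qed
    also have "\<dots> = x * H N - x * H (Suc N)"
      unfolding wrec H_def x_def[symmetric] y_def[symmetric] using x0 y0 by (simp add: xy)
    also have "\<dots> = x * (H N - H (Suc N))"
      by (simp add: algebra_simps)
    finally have "w (Suc N) * (poly T x + poly T (- x)) = H N - H (Suc N)"
      using x0 by (simp only: mult_cancel_left) simp
    then show ?case
      using Suc.IH by (simp add: x_def)
  qed
  \<comment> \<open>The constant term of \<open>F\<close> cancels in \<open>F(x) - F(-x)\<close>, so
    division by the node leaves a polynomial \<open>K\<close> summed over both signs. Hence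
    \<open>H\<close> is the general term of the convergent series for \<open>qfun K\<close> and
    tends to 0.\<close>
  obtain c g where Fg: "F = pCons c g" by (cases F) auto
  define K where "K = [:1, 0, -1:] * g"
  have "H s = w s * (poly K (xnode s) + poly K (- xnode s))" for s
    using xnode_nonzero[of s]
    by (simp add: H_def K_def Fg field_simps power2_eq_square)
  moreover have "(\<lambda>s. w s * (poly K (xnode s) + poly K (- xnode s))) \<longlonglongrightarrow> 0"
    unfolding w_def using qfun_sums[of K] by (intro summable_LIMSEQ_zero) (rule sums_summable)
  ultimately have "H \<longlonglongrightarrow> 0" by presburger
  then have "(\<lambda>N. - H N) \<longlonglongrightarrow> 0" using tendsto_minus[of H 0] by simp
  moreover have "(\<lambda>N. \<Sum>s<Suc N. w s * (poly T (xnode s) + poly T (- xnode s))) \<longlonglongrightarrow> qfun T"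
    using qfun_sums[of T] unfolding sums_def w_def by (rule LIMSEQ_Suc)
  ultimately show ?thesis
    unfolding partial using LIMSEQ_unique by blast
qed

text \<open>Apply the telescoping lemma to \<open>G = (x;q)_m (-x;q)_k\<close> and its dilation
  \<open>F(x) = G(qx)\<close>. As \<open>(1 - x^2) F(x)\<close> is
  \<open>(x;q)_{m+1} (-x;q)_{k+1}\<close>, it equals \<open>(1 - x q^m)(1 + x q^k) G(x)\<close>. The
  combination to be summed is then \<open>x\<close> times a linear factor times \<open>G\<close>,
  and that linear factor gives the relation.\<close>

lemma qfun_bases_mult_X:
  "(1 + A * Q ^ (m + k + 2)) * qfun ([:0, 1:] * (pos_base m * neg_base k))
     = - A * Q ^ 2 * (Q ^ m - Q ^ k) * qfun (pos_base m * neg_base k)"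
proof -
  define G where "G = pos_base m * neg_base k"
  define F where "F = qpoch [:0, Q:] [:Q:] m * qpoch [:0, -Q:] [:Q:] k"
  define T where "T = smult (A * Q ^ 2 * (Q ^ m - Q ^ k)) G + smult (1 + A * Q ^ (m + k + 2)) ([:0, 1:] * G)"
  have AQ: "A * Q ^ 2 \<noteq> 0" using a q by simp
  have "qfun (smult (inverse (A * Q ^ 2)) T) = 0"
  proof (rule qfun_eq_0_telescope[where F = F and G = G])
    show "poly G (Q * x) = poly F x" for x
      by (simp add: G_def F_def poly_qpoch mult.commute)
    fix x
    have "(1 - x ^ 2) * poly F x
        = ((1 - x) * qpoch (x * Q) Q m) * ((1 - - x) * qpoch (- x * Q) Q k)"
      by (simp add: F_def poly_qpoch algebra_simps power2_eq_square)
    also have "\<dots> = qpoch x Q (Suc m) * qpoch (- x) Q (Suc k)"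
      unfolding qpoch_Suc_shift ..
    also have "\<dots> = (1 - x * Q ^ m) * (1 + x * Q ^ k) * poly G x"
      by (simp add: qpoch_Suc G_def poly_qpoch algebra_simps)
    finally have F: "(1 - x ^ 2) * poly F x = (1 - x * Q ^ m) * (1 + x * Q ^ k) * poly G x" .
    have "K * x * poly (smult (inverse K) T) x = x * poly T x" if "K \<noteq> 0" for K
      using that by simp
    from this[OF AQ] have "A * Q ^ 2 * x * poly (smult (inverse (A * Q ^ 2)) T) x = x * poly T x" .
    also have "\<dots> = (A * Q ^ 2 + x ^ 2) * poly G x
          - A * Q ^ 2 * ((1 - x * Q ^ m) * (1 + x * Q ^ k) * poly G x)"
      by (simp add: T_def algebra_simps power_add power2_eq_square)
    finally show "A * Q ^ 2 * x * poly (smult (inverse (A * Q ^ 2)) T) x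
        = (A * Q ^ 2 + x ^ 2) * poly G x - A * Q ^ 2 * (1 - x ^ 2) * poly F x"
      unfolding F[symmetric] by (simp only: mult.assoc)
  qed
  then have "qfun T = 0" using AQ by (simp add: qfun_smult)
  then show ?thesis
    unfolding T_def qfun_add qfun_smult G_def by (simp add: eq_neg_iff_add_eq_0 add.commute)
qed

text \<open>Since \<open>(x;q)_{m+1} = (1 - x q^m) (x;q)_m\<close>, the relation for multiplication
  by \<open>x\<close> applies; on the right the contributions containing \<open>k\<close> cancel,
  leaving a factor in \<open>m\<close> alone.\<close>

lemma qfun_pos_base_Suc:
  "(1 + A * Q ^ (m + k + 2)) * qfun (pos_base (Suc m) * neg_base k)
     = (1 + A * Q ^ (2 * m + 2)) * qfun (pos_base m * neg_base k)"
proof -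
  have "pos_base (Suc m) * neg_base k
      = pos_base m * neg_base k + smult (- (Q ^ m)) ([:0, 1:] * (pos_base m * neg_base k))"
    by (rule poly_eq_poly_eq_iff[THEN iffD1]) (simp add: fun_eq_iff qpoch_Suc poly_qpoch algebra_simps)
  then have e: "qfun (pos_base (Suc m) * neg_base k)
      = qfun (pos_base m * neg_base k) - Q ^ m * qfun ([:0, 1:] * (pos_base m * neg_base k))"
    by (simp only: qfun_add qfun_smult) simp
  have "(1 + A * Q ^ (m + k + 2)) * qfun (pos_base (Suc m) * neg_base k)
      = (1 + A * Q ^ (m + k + 2)) * qfun (pos_base m * neg_base k)
        - Q ^ m * ((1 + A * Q ^ (m + k + 2)) * qfun ([:0, 1:] * (pos_base m * neg_base k)))"
    unfolding e by (simp only: algebra_simps)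
  also have "\<dots> = ((1 + A * Q ^ (m + k + 2)) + Q ^ m * (A * Q ^ 2 * (Q ^ m - Q ^ k)))
                   * qfun (pos_base m * neg_base k)"
    unfolding qfun_bases_mult_X by (simp add: algebra_simps)
  also have "(1 + A * Q ^ (m + k + 2)) + Q ^ m * (A * Q ^ 2 * (Q ^ m - Q ^ k)) = 1 + A * Q ^ (2 * m + 2)"
    by (simp add: algebra_simps power_add mult_2_right power2_eq_square)
  finally show ?thesis .
qed

text \<open>The mirror image, with \<open>(-x;q)_{k+1} = (1 + x q^k) (-x;q)_k\<close>.\<close>

lemma qfun_neg_base_Suc:
  "(1 + A * Q ^ (m + k + 2)) * qfun (pos_base m * neg_base (Suc k))
     = (1 + A * Q ^ (2 * k + 2)) * qfun (pos_base m * neg_base k)"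
proof -
  have "pos_base m * neg_base (Suc k)
      = pos_base m * neg_base k + smult (Q ^ k) ([:0, 1:] * (pos_base m * neg_base k))"
    by (rule poly_eq_poly_eq_iff[THEN iffD1]) (simp add: fun_eq_iff qpoch_Suc poly_qpoch algebra_simps)
  then have e: "qfun (pos_base m * neg_base (Suc k))
      = qfun (pos_base m * neg_base k) + Q ^ k * qfun ([:0, 1:] * (pos_base m * neg_base k))"
    by (simp only: qfun_add qfun_smult)
  have "(1 + A * Q ^ (m + k + 2)) * qfun (pos_base m * neg_base (Suc k))
      = (1 + A * Q ^ (m + k + 2)) * qfun (pos_base m * neg_base k)
        + Q ^ k * ((1 + A * Q ^ (m + k + 2)) * qfun ([:0, 1:] * (pos_base m * neg_base k)))"
    unfolding e by (simp only: algebra_simps)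
  also have "\<dots> = ((1 + A * Q ^ (m + k + 2)) - Q ^ k * (A * Q ^ 2 * (Q ^ m - Q ^ k)))
                   * qfun (pos_base m * neg_base k)"
    unfolding qfun_bases_mult_X by (simp add: algebra_simps)
  also have "(1 + A * Q ^ (m + k + 2)) - Q ^ k * (A * Q ^ 2 * (Q ^ m - Q ^ k)) = 1 + A * Q ^ (2 * k + 2)"
    by (simp add: algebra_simps power_add mult_2_right power2_eq_square)
  finally show ?thesis .
qed

lemma qpoch_neg_complex_nonzero:
  assumes "c \<ge> 0" "r > 0"
  shows "qpoch (- of_real c :: complex) (of_real r) m \<noteq> 0"
  using qpoch_neg_pos[OF assms, of m] qpoch_of_real[of "- c" r m] by simp

lemma qpoch_AQ_nonzero: "qpoch (- A * Q ^ j) Q m \<noteq> 0"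
  using qpoch_neg_complex_nonzero[of "a * q ^ j" q m] a q by simp

lemma qpoch_AQ2_nonzero: "qpoch (- A * Q ^ j) (Q ^ 2) m \<noteq> 0"
  using qpoch_neg_complex_nonzero[of "a * q ^ j" "q ^ 2" m] a q by simp

lemma qpoch_QQ_nonzero: "qpoch Q Q m \<noteq> 0"
  using qpoch_q_pos[of m] qpoch_of_real[of q q m] by simp

lemma one_plus_AQ_nonzero: "1 + A * Q ^ j \<noteq> 0"
proof -
  have "1 + a * q ^ j > 0" using a q by (intro add_pos_nonneg) auto
  moreover have "1 + A * Q ^ j = of_real (1 + a * q ^ j)" by simp
  ultimately show ?thesis by (metis of_real_eq_0_iff less_irrefl)
qed

text \<open>Iterates the two contiguous relations, first in \<open>k\<close> at \<open>m = 0\<close>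
  and then in \<open>m\<close>. The indices interact only through
  \<open>(-aq^2;q)_{m+k}\<close>.\<close>

lemma qfun_pos_neg_base:
  "qfun (pos_base m * neg_base k) * qpoch (- A * Q ^ 2) Q (m + k)
     = qpoch (- A * Q ^ 2) (Q ^ 2) m * qpoch (- A * Q ^ 2) (Q ^ 2) k * qfun 1"
proof (induction m)
  case 0
  show ?case
  proof (induction k)
    case (Suc k)
    have "qfun (pos_base 0 * neg_base (Suc k)) * qpoch (- A * Q ^ 2) Q (0 + Suc k)
        = ((1 + A * Q ^ (0 + k + 2)) * qfun (pos_base 0 * neg_base (Suc k))) * qpoch (- A * Q ^ 2) Q (0 + k)"
      by (simp add: qpoch_Suc algebra_simps power_add power2_eq_square)
    also have "\<dots> = (1 + A * Q ^ (2 * k + 2))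
        * (qfun (pos_base 0 * neg_base k) * qpoch (- A * Q ^ 2) Q (0 + k))"
      unfolding qfun_neg_base_Suc by (simp only: mult.assoc)
    also have "\<dots> = qpoch (- A * Q ^ 2) (Q ^ 2) 0 * qpoch (- A * Q ^ 2) (Q ^ 2) (Suc k) * qfun 1"
      unfolding Suc.IH by (simp add: qpoch_Suc power_add flip: power_mult) (simp add: power2_eq_square)
    finally show ?case .
  qed simp
next
  case (Suc m)
  have "qfun (pos_base (Suc m) * neg_base k) * qpoch (- A * Q ^ 2) Q (Suc m + k)
      = ((1 + A * Q ^ (m + k + 2)) * qfun (pos_base (Suc m) * neg_base k)) * qpoch (- A * Q ^ 2) Q (m + k)"
    by (simp add: qpoch_Suc algebra_simps power_add power2_eq_square)
  also have "\<dots> = (1 + A * Q ^ (2 * m + 2))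
      * (qfun (pos_base m * neg_base k) * qpoch (- A * Q ^ 2) Q (m + k))"
    unfolding qfun_pos_base_Suc by (simp only: mult.assoc)
  also have "\<dots> = qpoch (- A * Q ^ 2) (Q ^ 2) (Suc m) * qpoch (- A * Q ^ 2) (Q ^ 2) k * qfun 1"
    unfolding Suc.IH by (simp add: qpoch_Suc power_add algebra_simps flip: power_mult) (simp add: power2_eq_square)
  finally show ?case .
qed

section \<open>The polynomials in the rotated variable and their orthogonality\<close>

text \<open>The coefficient of \<open>(x;q)_m\<close> in the terminating series, with the two
  opposite lower parameters merged into one shifted factorial of base \<open>q^2\<close>.\<close>

definition Ccoeff :: "nat \<Rightarrow> nat \<Rightarrow> complex" where
  "Ccoeff n m = qpoch (inverse Q ^ n) Q m * qpoch (- A * Q ^ (n + 1)) Q m /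
     (qpoch (- A * Q ^ 2) (Q ^ 2) m * qpoch Q Q m) * Q ^ m"

text \<open>The big \<open>q\<close>-Jacobi polynomial with parameters \<open>\<i> \<surd>a\<close>,
  \<open>\<i> \<surd>a\<close>, \<open>-\<i> \<surd>a\<close>, kept as a formal polynomial so that
  its coefficients are available.\<close>

definition Cpoly :: "nat \<Rightarrow> complex poly" where
  "Cpoly n = (\<Sum>m\<le>n. smult (Ccoeff n m) (pos_base m))"

lemma Ctilde_eq_Cpoly: "Ctilde a q n x = (- \<i>) ^ n * poly (Cpoly n) (\<i> * x)"
proof -
  have Q0: "Q \<noteq> 0" using q by simp
  have i: "of_real (q powi (- int n)) = inverse Q ^ n"
    by (simp add: power_int_minus power_inverse)
  have b: "of_real (- a * q ^ (n + 1)) = - A * Q ^ (n + 1)" by simp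
  \<comment> \<open>The product \<open>(b;q)_m (-b;q)_m = (b^2;q^2)_m\<close> with
    \<open>b = \<i> \<surd>a q\<close>, whose square is \<open>- a q^2\<close>.\<close>
  have d: "qpoch (\<i> * of_real (sqrt a) * Q) Q m * qpoch (- \<i> * of_real (sqrt a) * Q) Q m
      = qpoch (- A * Q ^ 2) (Q ^ 2) m" for m
  proof -
    have "(\<i> * of_real (sqrt a) * Q) ^ 2 = - of_real (sqrt a ^ 2) * Q ^ 2"
      by (simp add: power_mult_distrib)
    also have "sqrt a ^ 2 = a" using a by simp
    finally show ?thesis
      using qpoch_mult_uminus[of "\<i> * of_real (sqrt a) * Q" Q m] by simp
  qed
  have "phi32 (of_real (q powi (- int n))) (of_real (- a * q ^ (n + 1))) (\<i> * x)
           (\<i> * of_real (sqrt a) * of_real q) (- \<i> * of_real (sqrt a) * of_real q) Q Q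
      = (\<Sum>m. Ccoeff n m * qpoch (\<i> * x) Q m)"
    unfolding phi32_def i b d Ccoeff_def by (intro suminf_cong) simp
  also have "\<dots> = (\<Sum>m\<le>n. Ccoeff n m * qpoch (\<i> * x) Q m)"
    by (rule suminf_finite) (auto simp: Ccoeff_def qpoch_neg_power_eq_0[OF Q0])
  also have "\<dots> = poly (Cpoly n) (\<i> * x)"
    by (simp add: Cpoly_def poly_sum poly_qpoch)
  finally show ?thesis by (simp add: Ctilde_def)
qed

text \<open>Makes the degree of \<open>Cpoly n\<close> exactly \<open>n\<close>, so that these
  polynomials form a triangular basis.\<close>

lemma Ccoeff_nonzero: "Ccoeff n n \<noteq> 0"
proof -
  have "qpoch (inverse Q ^ n) Q n \<noteq> 0"
    using qpoch_neg_power_same[of Q n] q qpoch_QQ_nonzero[of n] by auto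
  then show ?thesis
    unfolding Ccoeff_def
    using qpoch_AQ_nonzero[of "n + 1" n] qpoch_AQ2_nonzero[of 2 n] qpoch_QQ_nonzero[of n] q by simp
qed

lemma coeff_pos_base:
  "coeff (pos_base m) m = (- 1) ^ m * Q ^ (m * (m - 1) div 2)"
  "i > m \<Longrightarrow> coeff (pos_base m) i = 0"
  using coeff_qpoch_linear[where c = 1 and q = Q and m = m] by auto

lemma coeff_neg_base:
  "coeff (neg_base m) m = Q ^ (m * (m - 1) div 2)"
  "i > m \<Longrightarrow> coeff (neg_base m) i = 0"
  using coeff_qpoch_linear[where c = "-1" and q = Q and m = m] by auto

lemma coeff_Cpoly:
  "coeff (Cpoly n) n = Ccoeff n n * (- 1) ^ n * Q ^ (n * (n - 1) div 2)"
  "i > n \<Longrightarrow> coeff (Cpoly n) i = 0"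
proof -
  have "coeff (Cpoly n) n = (\<Sum>m\<le>n. Ccoeff n m * coeff (pos_base m) n)"
    by (simp add: Cpoly_def coeff_sum)
  also have "\<dots> = (\<Sum>m\<in>{n}. Ccoeff n m * coeff (pos_base m) n)"
    by (intro sum.mono_neutral_right) (auto simp: coeff_pos_base(2))
  finally show "coeff (Cpoly n) n = Ccoeff n n * (- 1) ^ n * Q ^ (n * (n - 1) div 2)"
    by (simp add: coeff_pos_base)
  show "coeff (Cpoly n) i = 0" if "i > n"
    using that by (auto simp: Cpoly_def coeff_sum coeff_pos_base(2) intro!: sum.neutral)
qed

text \<open>The factor \<open>(-aq^2;q^2)_m\<close> cancels between the coefficient and the
  functional. What remains is a terminating 2phi1 with upper parameters \<open>q^-n\<close>,
  \<open>-aq^{n+1}\<close>, lower parameter \<open>-aq^{k+2}\<close> and argument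
  \<open>q\<close>.\<close>

lemma qfun_Cpoly_neg_base:
  "qfun (Cpoly n * neg_base k) * (qpoch (- A * Q ^ 2) Q k * qpoch (- A * Q ^ (k + 2)) Q n)
     = qpoch (- A * Q ^ 2) (Q ^ 2) k * qfun 1 * (\<Prod>j<n. - A * Q ^ (n + 1) - - A * Q ^ (k + 2) * Q ^ j)"
proof -
  \<comment> \<open>All that is independent of \<open>m\<close> once \<open>(-aq^2;q)_{m+k}\<close>
    is split as \<open>(-aq^2;q)_k (-aq^{k+2};q)_m\<close>.\<close>
  define D where "D = qpoch (- A * Q ^ 2) (Q ^ 2) k * qfun 1 / qpoch (- A * Q ^ 2) Q k"
  have Q0: "Q \<noteq> 0" using q by simp
  have Qn: "Q ^ Suc j \<noteq> 1" for j
    using q_power_neq_1[of j] by (metis of_real_power of_real_1 of_real_eq_iff)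
  have cn: "- A * Q ^ (k + 2) * Q ^ j \<noteq> 1" for j
  proof -
    have "1 + A * Q ^ (k + 2 + j) = 1 - (- A * Q ^ (k + 2) * Q ^ j)"
      by (simp add: power_add mult.assoc)
    then show ?thesis using one_plus_AQ_nonzero[of "k + 2 + j"] by (metis diff_self)
  qed
  have "qfun (Cpoly n * neg_base k) = (\<Sum>m\<le>n. Ccoeff n m * qfun (pos_base m * neg_base k))"
    by (simp add: Cpoly_def sum_distrib_right qfun_sum qfun_smult)
  also have "\<dots> = (\<Sum>m\<le>n. D * (qpoch (inverse Q ^ n) Q m * qpoch (- A * Q ^ (n + 1)) Q m /
                   (qpoch Q Q m * qpoch (- A * Q ^ (k + 2)) Q m) * Q ^ m))"
  proof (rule sum.cong[OF refl])
    fix m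
    have "qpoch (- A * Q ^ 2) Q (m + k) = qpoch (- A * Q ^ 2) Q k * qpoch (- A * Q ^ (k + 2)) Q m"
      using qpoch_add[of "- A * Q ^ 2" Q k m] by (simp add: add.commute power_add mult_ac power2_eq_square)
    then have "qfun (pos_base m * neg_base k)
        * (qpoch (- A * Q ^ 2) Q k * qpoch (- A * Q ^ (k + 2)) Q m)
      = qpoch (- A * Q ^ 2) (Q ^ 2) m * qpoch (- A * Q ^ 2) (Q ^ 2) k * qfun 1"
      using qfun_pos_neg_base[of m k] by simp
    then have "qfun (pos_base m * neg_base k)
      = qpoch (- A * Q ^ 2) (Q ^ 2) m * D / qpoch (- A * Q ^ (k + 2)) Q m"
      unfolding D_def using qpoch_AQ_nonzero[of 2 k] qpoch_AQ_nonzero[of "k + 2" m]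
      by (simp add: eq_divide_eq mult_ac)
    then show "Ccoeff n m * qfun (pos_base m * neg_base k)
      = D * (qpoch (inverse Q ^ n) Q m * qpoch (- A * Q ^ (n + 1)) Q m /
                   (qpoch Q Q m * qpoch (- A * Q ^ (k + 2)) Q m) * Q ^ m)"
      unfolding Ccoeff_def using qpoch_AQ2_nonzero[of 2 m] by simp
  qed
  also have "\<dots> = D * ((\<Prod>j<n. - A * Q ^ (n + 1) - - A * Q ^ (k + 2) * Q ^ j) / qpoch (- A * Q ^ (k + 2)) Q n)"
    unfolding sum_distrib_left[symmetric] q_Chu_Vandermonde[OF Q0 Qn cn] ..
  finally show ?thesis
    unfolding D_def using qpoch_AQ_nonzero[of 2 k] qpoch_AQ_nonzero[of "k + 2" n]
    by (simp add: mult_ac)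
qed

lemma qfun_Cpoly_neg_base_less:
  assumes "k < n"
  shows "qfun (Cpoly n * neg_base k) = 0"
proof -
  \<comment> \<open>In the factor with \<open>j = n - 1 - k\<close> the exponents agree:
    \<open>n + 1 = k + 2 + j\<close>. This index is in range because \<open>k < n\<close>.\<close>
  have "- A * Q ^ (n + 1) - - A * Q ^ (k + 2) * Q ^ (n - 1 - k) = 0"
    using assms by (simp flip: power_add power_Suc)
  then have "(\<Prod>j<n. - A * Q ^ (n + 1) - - A * Q ^ (k + 2) * Q ^ j) = 0"
    using assms by (intro prod_zero bexI[of _ "n - 1 - k"]) auto
  then have "qfun (Cpoly n * neg_base k) * (qpoch (- A * Q ^ 2) Q k * qpoch (- A * Q ^ (k + 2)) Q n) = 0"
    unfolding qfun_Cpoly_neg_base by (simp only: mult_zero_right)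
  then show ?thesis
    using qpoch_AQ_nonzero[of 2 k] qpoch_AQ_nonzero[of "k + 2" n] by simp
qed

text \<open>The \<open>neg_base k\<close> with \<open>k < n\<close> span all polynomials of degree
  below \<open>n\<close>.\<close>

lemma qfun_Cpoly_lower_degree:
  assumes "\<And>i. i \<ge> n \<Longrightarrow> coeff p i = 0"
  shows "qfun (Cpoly n * p) = 0"
proof -
  obtain \<alpha> where p: "p = (\<Sum>k<n. smult (\<alpha> k) (neg_base k))"
    using triangular_poly_span[of neg_base n p] assms coeff_neg_base q by auto
  show ?thesis
    unfolding p sum_distrib_left qfun_sum mult_smult_right qfun_smult
    by (intro sum.neutral) (auto simp: qfun_Cpoly_neg_base_less)
qed

lemma qfun_Cpoly_orthogonal:
  assumes "n \<noteq> n'"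
  shows "qfun (Cpoly n * Cpoly n') = 0"
proof (cases "n' < n")
  case True
  then show ?thesis by (intro qfun_Cpoly_lower_degree coeff_Cpoly(2)) auto
next
  case False
  then show ?thesis
    using assms by (subst mult.commute, intro qfun_Cpoly_lower_degree coeff_Cpoly(2)) auto
qed

text \<open>One factor \<open>Cpoly n\<close> may be replaced by the multiple of
  \<open>neg_base n\<close> with the same leading coefficient, since the difference has lower degree
  and is annihilated. The sign on the left is the \<open>(-\<i>)^{2n}\<close> from the normalization
  of \<open>Ctilde\<close>.\<close>

lemma qfun_Cpoly_square:
  "(- 1) ^ n * qfun (Cpoly n * Cpoly n) =
     qfun 1 * ((1 + A * Q) * A ^ n / (1 + A * Q ^ (2 * n + 1)))
       * (qpoch Q Q n / qpoch (- A * Q) Q n) * Q ^ (n * (n + 3) div 2)"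
proof -
  \<comment> \<open>Naming the triangular number turns all halved exponents into sums.\<close>
  define t where "t = n * (n + 1) div 2"
  have t: "n * (n + 1) = t + t" "n * (n + 3) div 2 = n + t"
  proof -
    show "n * (n + 1) = t + t" unfolding t_def by (simp flip: mult_2)
    have "n * (n + 3) = n * 2 + n * (n + 1)" by (simp add: algebra_simps)
    then show "n * (n + 3) div 2 = n + t" unfolding t_def by (simp only: div_mult_self3)
  qed
  define P S V B R where
    "P = qpoch (- A * Q ^ 2) (Q ^ 2) n" and "S = qpoch (- A * Q ^ 2) Q n" and
    "V = qpoch (- A * Q ^ (n + 2)) Q n" and "B = qpoch (- A * Q ^ (n + 1)) Q n" and
    "R = qpoch (inverse Q ^ n) Q n"
  have nz: "P \<noteq> 0" "S \<noteq> 0" "V \<noteq> 0" "B \<noteq> 0" "qpoch Q Q n \<noteq> 0"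
    by (simp_all only: P_def S_def V_def B_def qpoch_AQ_nonzero qpoch_AQ2_nonzero
          qpoch_QQ_nonzero not_False_eq_True)
  \<comment> \<open>The ratio of the leading coefficients of \<open>Cpoly n\<close> and
    \<open>neg_base n\<close>.\<close>
  define c where "c = (- 1) ^ n * Ccoeff n n"
  have "coeff (Cpoly n - smult c (neg_base n)) i = 0" if "i \<ge> n" for i
    using that coeff_Cpoly[of n] coeff_neg_base[of n] coeff_Cpoly(2)[of n i] coeff_neg_base(2)[of n i]
    by (cases "i = n") (auto simp: c_def)
  then have "qfun (Cpoly n * (Cpoly n - smult c (neg_base n))) = 0"
    by (rule qfun_Cpoly_lower_degree)
  moreover have "Cpoly n * Cpoly n
      = Cpoly n * (Cpoly n - smult c (neg_base n)) + smult c (Cpoly n * neg_base n)"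
    by (simp add: algebra_simps)
  ultimately have 1: "qfun (Cpoly n * Cpoly n) = c * qfun (Cpoly n * neg_base n)"
    by (metis qfun_add qfun_smult add_0)
  have "(\<Prod>j<n. - A * Q ^ (n + 1) - - A * Q ^ (n + 2) * Q ^ j)
      = (\<Prod>j<n. (- A * Q ^ (n + 1)) * (1 - Q * Q ^ j))"
    by (intro prod.cong refl) (simp add: algebra_simps)
  also have "\<dots> = (- A * Q ^ (n + 1)) ^ n * qpoch Q Q n"
    unfolding prod.distrib by (simp only: qpoch_def prod_constant card_lessThan power_mult_distrib)
  also have "(- A * Q ^ (n + 1)) ^ n = (- 1) ^ n * A ^ n * Q ^ (n * (n + 1))"
    by (simp only: power_mult_distrib power_minus[of A] mult.commute[of n] flip: power_mult)
  finally have "(\<Prod>j<n. - A * Q ^ (n + 1) - - A * Q ^ (n + 2) * Q ^ j)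
      = (- 1) ^ n * A ^ n * Q ^ (t + t) * qpoch Q Q n" unfolding t .
  from qfun_Cpoly_neg_base[of n n, unfolded this]
  have "qfun (Cpoly n * neg_base n) * (S * V)
      = P * qfun 1 * ((- 1) ^ n * A ^ n * Q ^ (t + t) * qpoch Q Q n)"
    by (simp only: P_def S_def V_def)
  then have 2: "qfun (Cpoly n * neg_base n)
      = P * qfun 1 * ((- 1) ^ n * A ^ n * Q ^ (t + t) * qpoch Q Q n) / (S * V)"
    using nz by (simp add: eq_divide_eq)
  have 3: "Ccoeff n n = R * B / (P * qpoch Q Q n) * Q ^ n"
    by (simp add: Ccoeff_def R_def B_def P_def)
  have sq: "(- 1) ^ n * (- 1) ^ n = (1 :: complex)"
    by (simp flip: power_mult_distrib)
  have 4: "R * Q ^ t = (- 1) ^ n * qpoch Q Q n"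
    unfolding R_def t_def using q by (intro qpoch_neg_power_same) simp
  \<comment> \<open>Both sides are \<open>(-aq;q)_{2n+1}\<close>: once with its first factor split
    off and the rest halved, once with its last factor split off and the rest halved.\<close>
  have "(1 + A * Q) * (S * V) = qpoch (- A * Q) Q (Suc (n + n))"
    using qpoch_add[of "- A * Q ^ 2" Q n n] unfolding qpoch_Suc_shift[of "- A * Q"]
    by (simp add: S_def V_def power2_eq_square power_add mult_ac)
  also have "\<dots> = qpoch (- A * Q) Q n * B * (1 + A * Q ^ (2 * n + 1))"
    unfolding qpoch_Suc qpoch_add by (simp add: B_def power_add mult_ac mult_2_right)
  finally have 5: "(1 + A * Q) * (S * V) = qpoch (- A * Q) Q n * B * (1 + A * Q ^ (2 * n + 1))" .
  have nz': "1 + A * Q ^ (2 * n + 1) \<noteq> 0" "qpoch (- A * Q) Q n \<noteq> 0"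
    using one_plus_AQ_nonzero[of "2 * n + 1"] qpoch_AQ_nonzero[of 1 n] by simp_all
  have 6: "B / (S * V) = (1 + A * Q) / (qpoch (- A * Q) Q n * (1 + A * Q ^ (2 * n + 1)))"
    using 5 nz nz' by (simp add: frac_eq_eq mult_ac)
  have "(- 1) ^ n * qfun (Cpoly n * Cpoly n)
      = ((- 1) ^ n * (- 1) ^ n) * (- 1) ^ n * (R * Q ^ t) * A ^ n * Q ^ (n + t) * qfun 1 * (B / (S * V))"
    unfolding 1 2 3 c_def power_add using nz(1,5) by simp
  also have "\<dots> = ((- 1) ^ n * (- 1) ^ n) * qpoch Q Q n * A ^ n * Q ^ (n + t) * qfun 1 * (B / (S * V))"
    unfolding 4 sq by (simp only: mult.assoc[symmetric] sq mult_1)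
  also have "\<dots> = qfun 1 * ((1 + A * Q) * A ^ n / (1 + A * Q ^ (2 * n + 1)))
       * (qpoch Q Q n / qpoch (- A * Q) Q n) * Q ^ (n * (n + 3) div 2)"
    unfolding 6 sq t by (simp add: mult_ac)
  finally show ?thesis .
qed

end

subsection \<open>Determinacy of compactly supported measures\<close>

text \<open>Open half-lines determine a finite measure, and their indicators are pointwise limits of
  continuous ramps with values in \<open>[0, 1]\<close>; dominated convergence transfers the
  equality of integrals.\<close>

lemma finite_borel_measure_eqI_continuous:
  fixes M N :: "real measure"
  assumes sets: "sets M = sets borel" "sets N = sets borel"
    and fin: "finite_measure M" "finite_measure N"
    and eq: "\<And>f. continuous_on UNIV f \<Longrightarrow> (\<And>x. \<bar>f x\<bar> \<le> 1) \<Longrightarrow>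
                 (\<integral>x. f x \<partial>M) = (\<integral>x. (f x :: real) \<partial>N)"
  shows "M = N"
proof -
  interpret M: finite_measure M by fact
  interpret N: finite_measure N by fact
  have lim: "(\<lambda>n. \<integral>x. min 1 (max 0 (real n * (x - c))) \<partial>K) \<longlonglongrightarrow> measure K {c<..}"
    if K: "sets K = sets borel" "finite_measure K" for K :: "real measure" and c
  proof -
    interpret K: finite_measure K by fact
    have [measurable_cong]: "sets K = sets borel" by fact
    have "(\<lambda>n. \<integral>x. min 1 (max 0 (real n * (x - c))) \<partial>K) \<longlonglongrightarrow> (\<integral>x. indicator {c<..} x \<partial>K)"
    proof (rule integral_dominated_convergence[where w = "\<lambda>_. 1"])
      have "(\<lambda>n. min 1 (max 0 (real n * (x - c)))) \<longlonglongrightarrow> indicator {c<..} x" for x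
      proof (cases "x > c")
        case True
        have "eventually (\<lambda>n. real n \<ge> 1 / (x - c)) sequentially"
          using filterlim_real_sequentially by (simp add: filterlim_at_top)
        then have "eventually (\<lambda>n. min 1 (max 0 (real n * (x - c))) = indicator {c<..} x) sequentially"
          by eventually_elim (use True in \<open>simp add: field_simps\<close>)
        then show ?thesis by (rule tendsto_eventually)
      next
        case False
        then have "max 0 (real n * (x - c)) = 0" for n
          by (intro max_absorb1) (simp add: mult_le_0_iff)
        then show ?thesis using False by simp
      qed
      then show "AE x in K. (\<lambda>n. min 1 (max 0 (real n * (x - c)))) \<longlonglongrightarrow> indicator {c<..} x"
        by simp
    qed (use K in auto)
    also have "(\<integral>x. indicator {c<..} x \<partial>K) = measure K {c<..}"
      using K by (simp add: sets_eq_imp_space_eq[OF K(1)])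
    finally show ?thesis .
  qed
  show ?thesis
  proof (rule measure_eqI_lessThan[OF sets])
    fix c
    show "emeasure M {c<..} < \<infinity>"
      using M.emeasure_finite by (simp add: less_top[symmetric])
    have "(\<lambda>n. \<integral>x. min 1 (max 0 (real n * (x - c))) \<partial>M) = (\<lambda>n. \<integral>x. min 1 (max 0 (real n * (x - c))) \<partial>N)"
      by (intro ext eq) (auto intro!: continuous_intros)
    with lim[OF sets(1) fin(1), of c] lim[OF sets(2) fin(2), of c]
    have "measure M {c<..} = measure N {c<..}" by (simp add: LIMSEQ_unique)
    then show "emeasure M {c<..} = emeasure N {c<..}"
      by (simp add: M.emeasure_eq_measure N.emeasure_eq_measure)
  qed
qed

text \<open>Integrability of \<open>x^0\<close> bounds the total mass.\<close>

lemma has_all_moments_finite_measure: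
  assumes "has_all_moments M"
  shows "finite_measure M"
proof -
  have "integrable M (\<lambda>x. x ^ 0)" using assms unfolding has_all_moments_def by blast
  then show ?thesis
    by (intro finite_measureI) (auto simp: integrable_iff_bounded top.not_eq_extremum)
qed

text \<open>The even moments force \<open>N\<close> to live on a bounded interval too. There
  polynomials approximate continuous functions uniformly, so equal moments give equal
  integrals.\<close>

lemma compact_support_moment_determinate:
  fixes M N :: "real measure"
  assumes M: "has_all_moments M" and N: "has_all_moments N"
    and supp: "AE x in M. \<bar>x\<bar> \<le> R" and R: "R \<ge> 0"
    and eq: "\<And>k::nat. (\<integral>x. x ^ k \<partial>N) = (\<integral>x. x ^ k \<partial>M)"
  shows "N = M"
proof -
  have sets: "sets M = sets borel" "sets N = sets borel"
    and int: "\<And>k. integrable M (\<lambda>x. x ^ k)" "\<And>k. integrable N (\<lambda>x. x ^ k)"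
    using M N by (auto simp: has_all_moments_def)
  have fin: "finite_measure M" "finite_measure N"
    using M N by (auto intro: has_all_moments_finite_measure)
  interpret M: finite_measure M by fact
  interpret N: finite_measure N by fact
  have [measurable_cong]: "sets M = sets borel" "sets N = sets borel" by fact+
  have space: "space M = UNIV" "space N = UNIV"
    using sets by (auto dest: sets_eq_imp_space_eq)
  \<comment> \<open>Any radius strictly above \<open>R\<close> works; adding 1 also makes it
    positive when \<open>R = 0\<close>.\<close>
  define S where "S = R + 1"
  define B where "B = {x::real. \<bar>x\<bar> \<ge> S}"
  have B: "B \<in> sets N" unfolding B_def by measurable
  \<comment> \<open>Markov's inequality for \<open>x^{2k}\<close>; the bound tends to 0 as
    \<open>k\<close> grows because \<open>R < S\<close>.\<close>
  have tail: "measure N B \<le> (R / S) ^ (2 * k) * measure M UNIV" for k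
  proof -
    have "S ^ (2 * k) * measure N B = (\<integral>x. S ^ (2 * k) * indicator B x \<partial>N)"
      using B by (simp add: space)
    also have "\<dots> \<le> (\<integral>x. x ^ (2 * k) \<partial>N)"
    proof (rule integral_mono)
      fix x :: real
      show "S ^ (2 * k) * indicator B x \<le> x ^ (2 * k)"
        using R power_mono[of S "\<bar>x\<bar>" "2 * k"]
        by (auto simp: B_def S_def power_even_abs split: split_indicator)
    next
      have "integrable N (indicator B :: real \<Rightarrow> real)"
        using B by (intro integrable_real_indicator) (simp_all add: N.emeasure_eq_measure)
      then show "integrable N (\<lambda>x. S ^ (2 * k) * indicator B x)" by (rule integrable_mult_right)
    qed (use int in auto)
    also have "\<dots> = (\<integral>x. x ^ (2 * k) \<partial>M)" by (rule eq)
    also have "\<dots> \<le> (\<integral>x. R ^ (2 * k) \<partial>M)"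
    proof (rule integral_mono_AE)
      show "AE x in M. x ^ (2 * k) \<le> R ^ (2 * k)"
        using supp
      proof eventually_elim
        fix x :: real assume "\<bar>x\<bar> \<le> R"
        then show "x ^ (2 * k) \<le> R ^ (2 * k)"
          using power_mono[of "\<bar>x\<bar>" R "2 * k"] by (simp add: power_even_abs)
      qed
    qed (use int in auto)
    also have "\<dots> = R ^ (2 * k) * measure M UNIV" by (simp add: space)
    finally show ?thesis using R by (simp add: S_def power_divide field_simps)
  qed
  have "(\<lambda>k. (R / S) ^ (2 * k) * measure M UNIV) \<longlonglongrightarrow> 0 * measure M UNIV"
    unfolding power_mult using R
    by (intro tendsto_intros LIMSEQ_power_zero) (auto simp: S_def power_divide power_strict_mono)
  then have "measure N B \<le> 0"
    using tail by (intro LIMSEQ_le_const) auto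
  then have "emeasure N B = 0"
    by (simp add: N.emeasure_eq_measure measure_le_0_iff)
  then have suppN: "AE x in N. \<bar>x\<bar> \<le> S"
    using B by (intro AE_I[of N _ B]) (auto simp: B_def)
  have suppM: "AE x in M. \<bar>x\<bar> \<le> S"
    using supp by eventually_elim (simp add: S_def)
  show ?thesis
  proof (rule finite_borel_measure_eqI_continuous[OF sets(2,1) fin(2,1)])
    fix f :: "real \<Rightarrow> real"
    assume f: "continuous_on UNIV f" "\<And>x. \<bar>f x\<bar> \<le> 1"
    have [measurable]: "f \<in> borel_measurable borel" using f(1) by (rule borel_measurable_continuous_onI)
    have "\<bar>(\<integral>x. f x \<partial>N) - (\<integral>x. f x \<partial>M)\<bar> \<le> e * (measure N UNIV + measure M UNIV)" if "e > 0" for e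
    proof -
      have "continuous_on {-S..S} f" using f(1) by (rule continuous_on_subset) auto
      then obtain g where g: "real_polynomial_function g" "\<And>x. x \<in> {-S..S} \<Longrightarrow> \<bar>f x - g x\<bar> < e"
        using Stone_Weierstrass_real_polynomial_function[of "{-S..S}" f e] \<open>e > 0\<close> by auto
      obtain c n where gs: "g = (\<lambda>x. \<Sum>i\<le>n. c i * x ^ i)"
        using g(1) unfolding real_polynomial_function_iff_sum by blast
      have close: "\<bar>(\<integral>x. f x \<partial>K) - (\<integral>x. g x \<partial>K)\<bar> \<le> e * measure K UNIV"
        if K: "finite_measure K" "sets K = sets borel" "AE x in K. \<bar>x\<bar> \<le> S"
          "\<And>k. integrable K (\<lambda>x. x ^ k)" for K
      proof -
        interpret K: finite_measure K by fact
        have [measurable_cong]: "sets K = sets borel" by fact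
        have if_: "integrable K f"
          using f(2) by (intro K.integrable_const_bound[of _ 1]) auto
        have ig: "integrable K g" unfolding gs using K(4) by auto
        have "\<bar>(\<integral>x. f x \<partial>K) - (\<integral>x. g x \<partial>K)\<bar> = \<bar>\<integral>x. f x - g x \<partial>K\<bar>"
          using if_ ig by simp
        also have "\<dots> \<le> (\<integral>x. \<bar>f x - g x\<bar> \<partial>K)" by (rule integral_abs_bound)
        also have "\<dots> \<le> (\<integral>x. e \<partial>K)"
        proof (rule integral_mono_AE)
          show "AE x in K. \<bar>f x - g x\<bar> \<le> e"
            using K(3) by eventually_elim (intro less_imp_le g(2), auto simp: abs_le_iff)
        qed (use if_ ig in auto)
        also have "\<dots> = e * measure K UNIV"
          using sets_eq_imp_space_eq[OF K(2)] by simp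
        finally show ?thesis .
      qed
      have "(\<integral>x. g x \<partial>N) = (\<integral>x. g x \<partial>M)"
        unfolding gs using int eq by simp
      then show ?thesis
        using close[OF fin(2) sets(2) suppN int(2)] close[OF fin(1) sets(1) suppM int(1)]
        by (simp add: algebra_simps)
    qed
    note bound = this
    define C where "C = measure N UNIV + measure M UNIV"
    \<comment> \<open>The approximation error is taken as \<open>e / (C + 1)\<close>, which is
      meaningful even for \<open>C = 0\<close>.\<close>
    have "\<bar>(\<integral>x. f x \<partial>N) - (\<integral>x. f x \<partial>M)\<bar> \<le> 0 + e" if "e > 0" for e
    proof -
      have "C \<ge> 0" by (simp add: C_def)
      then have "e / (C + 1) * C \<le> e"
        using that by (simp add: field_simps)
      then show ?thesis
        using bound[of "e / (C + 1)"] that \<open>C \<ge> 0\<close> unfolding C_def[symmetric] by simp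
    qed
    then show "(\<integral>x. f x \<partial>N) = (\<integral>x. f x \<partial>M)"
      using field_le_epsilon[of "\<bar>(\<integral>x. f x \<partial>N) - (\<integral>x. f x \<partial>M)\<bar>" 0] by fastforce
  qed
qed

subsection \<open>The discrete measure\<close>

lemma scale_measure_eq_density: "scale_measure r M = density M (\<lambda>_. r)"
  by (rule measure_eqI) (simp_all add: emeasure_density nn_integral_cmult_indicator)

lemma integrable_scale_measure:
  fixes f :: "'a \<Rightarrow> 'b::{banach, second_countable_topology}"
  assumes "integrable M f" "c \<ge> 0"
  shows "integrable (scale_measure (ennreal c) M) f"
  using assms unfolding scale_measure_eq_density by (subst integrable_density) auto

lemma integral_scale_measure:
  fixes f :: "'a \<Rightarrow> 'b::{banach, second_countable_topology}"
  assumes "integrable M f" "c \<ge> 0"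
  shows "(\<integral>x. f x \<partial>scale_measure (ennreal c) M) = c *\<^sub>R (\<integral>x. f x \<partial>M)"
  using assms unfolding scale_measure_eq_density by (subst integral_density) auto

lemma orthogonality_measure_scale:
  assumes "orthogonality_measure p M" "c > 0"
  shows "orthogonality_measure p (scale_measure (ennreal c) M)"
  using assms
  by (auto simp: orthogonality_measure_def integrable_scale_measure integral_scale_measure)

lemma has_all_moments_scale:
  assumes "has_all_moments M" "c > 0"
  shows "has_all_moments (scale_measure (ennreal c) M)"
  using assms by (auto simp: has_all_moments_def integrable_scale_measure)

text \<open>By absolute convergence the sum over the index set splits into one copy of the naturals
  for each sign, and each part is an ordinary series.\<close>

lemma integral_count_space_signs:
  fixes h :: "nat \<times> real \<Rightarrow> 'b::{banach, second_countable_topology}"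
  assumes "summable (\<lambda>s. norm (h (s, 1)))" "summable (\<lambda>s. norm (h (s, - 1)))"
  shows "integrable (count_space (UNIV \<times> {1, - 1})) h"
    and "(\<integral>x. h x \<partial>count_space (UNIV \<times> {1, - 1})) = (\<Sum>s. h (s, 1) + h (s, - 1))"
proof -
  define P N where "P = (\<lambda>s::nat. (s, 1::real)) ` UNIV" and "N = (\<lambda>s::nat. (s, - 1::real)) ` UNIV"
  have PN: "UNIV \<times> {1, - 1} = P \<union> N" "P \<inter> N = {}"
    by (auto simp: P_def N_def)
  have inj: "inj (\<lambda>s::nat. (s, 1::real))" "inj (\<lambda>s::nat. (s, - 1::real))"
    by (auto simp: inj_def)
  have abs: "Infinite_Set_Sum.abs_summable_on (\<lambda>s. h (s, 1)) UNIV"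
      "Infinite_Set_Sum.abs_summable_on (\<lambda>s. h (s, - 1)) UNIV"
    using assms by (auto simp: abs_summable_on_nat_iff')
  have absP: "Infinite_Set_Sum.abs_summable_on h P" and absN: "Infinite_Set_Sum.abs_summable_on h N"
    using abs inj by (auto simp: P_def N_def abs_summable_on_reindex_iff[symmetric])
  show "integrable (count_space (UNIV \<times> {1, - 1})) h"
    using absP absN unfolding PN(1) abs_summable_on_def[symmetric] by (rule abs_summable_on_union)
  have "infsetsum h (P \<union> N) = infsetsum h P + infsetsum h N"
    using absP absN PN(2) by (rule infsetsum_Un_disjoint)
  also have "infsetsum h P = infsetsum (\<lambda>s. h (s, 1)) UNIV"
    unfolding P_def using inj(1) by (rule infsetsum_reindex)
  also have "\<dots> = (\<Sum>s. h (s, 1))" by (rule infsetsum_nat'[OF abs(1)])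
  also have "infsetsum h N = infsetsum (\<lambda>s. h (s, - 1)) UNIV"
    unfolding N_def using inj(2) by (rule infsetsum_reindex)
  also have "\<dots> = (\<Sum>s. h (s, - 1))" by (rule infsetsum_nat'[OF abs(2)])
  also have "(\<Sum>s. h (s, 1)) + (\<Sum>s. h (s, - 1)) = (\<Sum>s. h (s, 1) + h (s, - 1))"
    using assms by (intro suminf_add) (auto intro: summable_norm_cancel)
  finally show "(\<integral>x. h x \<partial>count_space (UNIV \<times> {1, - 1})) = (\<Sum>s. h (s, 1) + h (s, - 1))"
    unfolding infsetsum_def PN(1) .
qed

section \<open>Integration against the discrete measure\<close>

context
  fixes a q :: real
  assumes q: "0 < q" "q < 1" and a: "a > 0"
begin

lemma node_eq: "\<i> * of_real (node a q s \<epsilon>) = of_real \<epsilon> * xnode a q s"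
  by (simp add: node_def xnode_def[OF q a])

lemma abs_node_le: "\<epsilon> \<in> {1, - 1} \<Longrightarrow> \<bar>node a q s \<epsilon>\<bar> \<le> sqrt a"
  using q a power_le_one[of q "s + 1"] by (auto simp: node_def abs_mult mult_left_le)

text \<open>A bound on the nodes alone suffices, because the weights are summable and the measure
  charges nothing else.\<close>

lemma discrete_measure_integral:
  fixes f :: "real \<Rightarrow> 'b::{banach, second_countable_topology}"
  assumes f: "f \<in> borel_measurable borel"
    and B: "\<And>s \<epsilon>. \<epsilon> \<in> {1, - 1} \<Longrightarrow> norm (f (node a q s \<epsilon>)) \<le> B"
  shows "integrable (discrete_measure a q) f"
    and "(\<integral>x. f x \<partial>discrete_measure a q)
           = (\<Sum>s. weight a q s *\<^sub>R f (node a q s 1) + weight a q s *\<^sub>R f (node a q s (- 1)))"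
proof -
  define C where "C = count_space (UNIV \<times> {1, - 1 :: real} :: (nat \<times> real) set)"
  define w where "w = (\<lambda>x :: nat \<times> real. weight a q (fst x))"
  define g where "g = (\<lambda>x :: nat \<times> real. node a q (fst x) (snd x))"
  have D: "discrete_measure a q = distr (density C (\<lambda>x. ennreal (w x))) borel g"
    by (simp add: discrete_measure_def C_def w_def g_def case_prod_unfold)
  have meas: "h \<in> measurable C K" if "\<And>x. h x \<in> space K" for h and K :: "'k measure"
    using that by (simp add: C_def)
  have w0: "w x \<ge> 0" for x
    unfolding w_def using weight_pos[OF q a] by (simp add: less_imp_le)
  have g: "g \<in> measurable (density C (\<lambda>x. ennreal (w x))) borel"
    by (simp add: meas)
  have fg: "(\<lambda>x. f (g x)) \<in> borel_measurable C" by (simp add: meas)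
  have "summable (\<lambda>s. norm (w (s, \<epsilon>) *\<^sub>R f (g (s, \<epsilon>))))" if "\<epsilon> \<in> {1, - 1}" for \<epsilon>
  proof (rule summable_comparison_test)
    show "summable (\<lambda>s. weight a q s * B)"
      by (intro summable_mult2 summable_weight q a)
    show "\<exists>N. \<forall>s\<ge>N. norm (norm (w (s, \<epsilon>) *\<^sub>R f (g (s, \<epsilon>)))) \<le> weight a q s * B"
      using B[OF that] weight_pos[OF q a]
      by (auto simp: w_def g_def abs_mult less_imp_le intro!: mult_left_mono exI[of _ 0])
  qed
  then have s: "summable (\<lambda>s. norm (w (s, 1) *\<^sub>R f (g (s, 1))))"
       "summable (\<lambda>s. norm (w (s, - 1) *\<^sub>R f (g (s, - 1))))" by auto
  have w: "w \<in> borel_measurable C" by (simp add: meas)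
  note C = integral_count_space_signs[of "\<lambda>x. w x *\<^sub>R f (g x)", OF s, folded C_def]
  show "integrable (discrete_measure a q) f"
    unfolding D integrable_distr_eq[OF g f]
    using C(1) w0 by (subst integrable_density[OF fg w]) auto
  have "(\<integral>x. f x \<partial>discrete_measure a q) = (\<integral>x. w x *\<^sub>R f (g x) \<partial>C)"
    unfolding D integral_distr[OF g f] using w0 by (subst integral_density[OF fg w]) auto
  also have "\<dots> = (\<Sum>s. weight a q s *\<^sub>R f (node a q s 1) + weight a q s *\<^sub>R f (node a q s (- 1)))"
    unfolding C(2) by (simp add: w_def g_def)
  finally show "(\<integral>x. f x \<partial>discrete_measure a q)
           = (\<Sum>s. weight a q s *\<^sub>R f (node a q s 1) + weight a q s *\<^sub>R f (node a q s (- 1)))" .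
qed

lemma sets_discrete_measure [simp]: "sets (discrete_measure a q) = sets borel"
  by (simp add: discrete_measure_def)

lemma discrete_measure_AE_bounded: "AE x in discrete_measure a q. \<bar>x\<bar> \<le> sqrt a"
proof -
  have "{x \<in> space borel. \<bar>x\<bar> \<le> sqrt a} \<in> sets borel" by measurable
  moreover have "AE x in density (count_space (UNIV \<times> {1, -1})) (\<lambda>(s, \<epsilon>). ennreal (weight a q s)).
      \<bar>case x of (s, \<epsilon>) \<Rightarrow> node a q s \<epsilon>\<bar> \<le> sqrt a"
    by (subst AE_density) (simp, simp only: AE_count_space, clarsimp simp: abs_node_le)
  ultimately show ?thesis
    unfolding discrete_measure_def by (subst AE_distr_iff) simp_all
qed

lemma discrete_measure_has_all_moments: "has_all_moments (discrete_measure a q)"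
  unfolding has_all_moments_def
proof (intro conjI allI)
  fix k
  show "integrable (discrete_measure a q) (\<lambda>x. x ^ k)"
  proof (rule discrete_measure_integral(1))
    show "norm (node a q s \<epsilon> ^ k) \<le> sqrt a ^ k" if "\<epsilon> \<in> {1, - 1}" for s \<epsilon>
      using abs_node_le[OF that] by (simp add: power_abs power_mono)
  qed simp
qed simp

text \<open>Gives a nonzero measure, and later the denominator of the scaling constant.\<close>

lemma discrete_measure_total_pos: "measure (discrete_measure a q) UNIV > 0"
proof -
  have "(\<integral>x. (1 :: real) \<partial>discrete_measure a q) = (\<Sum>s. weight a q s + weight a q s)"
    by (subst discrete_measure_integral(2)[of _ 1]) simp_all
  moreover have "space (discrete_measure a q) = UNIV"
    by (simp add: discrete_measure_def)
  moreover have "(\<Sum>s. weight a q s + weight a q s) > 0"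
  proof (rule suminf_pos)
    show "summable (\<lambda>s. weight a q s + weight a q s)"
      by (intro summable_add summable_weight q a)
    show "0 < weight a q s + weight a q s" for s
      using weight_pos[OF q a, of s] by simp
  qed
  ultimately show ?thesis by simp
qed

text \<open>The bridge from the measure to the functional: \<open>x \<mapsto> \<i> x\<close> carries
  the real nodes to the points \<open>\<plusminus>xnode s\<close>.\<close>

lemma discrete_measure_poly:
  "integrable (discrete_measure a q) (\<lambda>x. poly p (\<i> * of_real x))"
  "(\<integral>x. poly p (\<i> * of_real x) \<partial>discrete_measure a q) = qfun a q p"
proof -
  obtain B where B: "\<And>s. norm (poly p (xnode a q s)) \<le> B" "\<And>s. norm (poly p (- xnode a q s)) \<le> B"
    by (rule poly_xnode_bounded[OF q a, of p]) blast
  have m: "(\<lambda>x. poly p (\<i> * complex_of_real x)) \<in> borel_measurable borel"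
    by (intro borel_measurable_continuous_onI continuous_intros)
  have b: "norm (poly p (\<i> * of_real (node a q s \<epsilon>))) \<le> B" if "\<epsilon> \<in> {1, - 1}" for s \<epsilon>
    unfolding node_eq using that B by auto
  show "integrable (discrete_measure a q) (\<lambda>x. poly p (\<i> * of_real x))"
    by (rule discrete_measure_integral(1)[OF m b])
  show "(\<integral>x. poly p (\<i> * of_real x) \<partial>discrete_measure a q) = qfun a q p"
  proof -
    have "(\<integral>x. poly p (\<i> * of_real x) \<partial>discrete_measure a q)
        = (\<Sum>s. weight a q s *\<^sub>R poly p (\<i> * of_real (node a q s 1))
                + weight a q s *\<^sub>R poly p (\<i> * of_real (node a q s (- 1))))"
      by (rule discrete_measure_integral(2)[OF m b])
    also have "\<dots> = qfun a q p"
      unfolding node_eq qfun_def[OF q a] by (simp add: scaleR_conv_of_real distrib_left)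
    finally show ?thesis .
  qed
qed

lemma Ctilde_mult:
  "Ctilde a q m x * Ctilde a q n x
     = poly (smult ((- \<i>) ^ (m + n)) (Cpoly a q m * Cpoly a q n)) (\<i> * x)"
  by (simp add: Ctilde_eq_Cpoly[OF q a] power_add)

lemma discrete_measure_orthogonality: "orthogonality_measure (Ctilde a q) (discrete_measure a q)"
proof -
  have "emeasure (discrete_measure a q) UNIV \<noteq> 0"
    using discrete_measure_total_pos by (auto simp: measure_def)
  then show ?thesis
    by (simp add: orthogonality_measure_def Ctilde_mult discrete_measure_poly
        qfun_smult[OF q a] qfun_Cpoly_orthogonal[OF q a] del: poly_smult poly_mult)
qed

section \<open>Uniqueness of the orthogonality measure\<close>

lemma Ctilde_0: "Ctilde a q 0 x = 1"
  by (simp add: Ctilde_eq_Cpoly[OF q a] Cpoly_def[OF q a] Ccoeff_def[OF q a])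

lemma orthogonality_measure_finite:
  assumes "orthogonality_measure (Ctilde a q) M"
  shows "finite_measure M"
proof -
  have "integrable M (\<lambda>x. Ctilde a q 0 (of_real x) * Ctilde a q 0 (of_real x))"
    using assms unfolding orthogonality_measure_def by blast
  then show ?thesis
    by (intro finite_measureI) (auto simp: Ctilde_0 integrable_iff_bounded top.not_eq_extremum)
qed

text \<open>As the polynomial of index 0 is 1, orthogonality to it annihilates the integral of every
  other basis element, leaving only the coefficient \<open>\<alpha> 0\<close> times the total
  mass.\<close>

lemma orthogonality_measure_poly:
  assumes M: "orthogonality_measure (Ctilde a q) M"
    and p: "p = (\<Sum>k<Suc N. smult (\<alpha> k) (Cpoly a q k))"
  shows "integrable M (\<lambda>x. poly p (\<i> * of_real x))"
    and "(\<integral>x. poly p (\<i> * of_real x) \<partial>M) = \<alpha> 0 * of_real (measure M UNIV)"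
proof -
  interpret finite_measure M by (rule orthogonality_measure_finite[OF M])
  have space: "space M = UNIV"
    using M by (auto simp: orthogonality_measure_def dest: sets_eq_imp_space_eq)
  \<comment> \<open>Multiplication by \<open>\<i>^k\<close> undoes the normalizing factor
    \<open>(-\<i>)^k\<close>.\<close>
  have e: "poly (Cpoly a q k) (\<i> * x) = \<i> ^ k * Ctilde a q k x" for k x
  proof -
    have "\<i> ^ k * (- \<i>) ^ k = 1" by (simp flip: power_mult_distrib)
    then show ?thesis by (simp add: Ctilde_eq_Cpoly[OF q a] flip: mult.assoc)
  qed
  have pe: "poly p (\<i> * x) = (\<Sum>k<Suc N. \<alpha> k * \<i> ^ k * Ctilde a q k x)" for x
    by (simp only: p poly_sum poly_smult e mult.assoc)
  have "integrable M (\<lambda>x. Ctilde a q k (of_real x) * Ctilde a q 0 (of_real x))" for k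
    using M unfolding orthogonality_measure_def by blast
  then have int: "integrable M (\<lambda>x. Ctilde a q k (of_real x))" for k
    by (simp add: Ctilde_0)
  have "k \<noteq> 0 \<Longrightarrow> (\<integral>x. Ctilde a q k (of_real x) * Ctilde a q 0 (of_real x) \<partial>M) = 0" for k
    using M unfolding orthogonality_measure_def by blast
  then have zero: "(\<integral>x. Ctilde a q (Suc k) (of_real x) \<partial>M) = 0" for k
    by (simp add: Ctilde_0)
  show "integrable M (\<lambda>x. poly p (\<i> * of_real x))"
    unfolding pe using int by (intro Bochner_Integration.integrable_sum integrable_mult_right)
  have "(\<integral>x. poly p (\<i> * of_real x) \<partial>M) = (\<Sum>k<Suc N. \<alpha> k * \<i> ^ k * (\<integral>x. Ctilde a q k (of_real x) \<partial>M))"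
    unfolding pe using int by (subst Bochner_Integration.integral_sum) (auto intro!: integrable_mult_right)
  also have "\<dots> = \<alpha> 0 * of_real (measure M UNIV)"
    unfolding sum.lessThan_Suc_shift by (simp add: zero Ctilde_0 space scaleR_conv_of_real)
  finally show "(\<integral>x. poly p (\<i> * of_real x) \<partial>M) = \<alpha> 0 * of_real (measure M UNIV)" .
qed

text \<open>The ratio of the \<open>k\<close>-th moment to the total mass is the coefficient of
  index 0 in the expansion of the monomial, hence is the same for every orthogonality measure.
  Cross-multiplication states this without division.\<close>

lemma orthogonality_measure_moments:
  assumes M: "orthogonality_measure (Ctilde a q) M"
  shows "has_all_moments M"
    and "(\<integral>x. x ^ k \<partial>M) * measure (discrete_measure a q) UNIV
           = (\<integral>x. x ^ k \<partial>discrete_measure a q) * measure M UNIV"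
proof -
  note D = discrete_measure_orthogonality
  \<comment> \<open>Chosen so that evaluation at \<open>\<i> x\<close> returns the real power
    \<open>x^k\<close>.\<close>
  define mon where "mon = (\<lambda>k. monom ((- \<i>) ^ k) k)"
  have mon: "poly (mon k) (\<i> * of_real x) = of_real (x ^ k)" for k x
  proof -
    have "(- \<i>) ^ k * \<i> ^ k = 1" by (simp flip: power_mult_distrib)
    then show ?thesis by (simp add: mon_def poly_monom power_mult_distrib flip: mult.assoc)
  qed
  have ex: "\<exists>\<alpha>. mon k = (\<Sum>j<Suc k. smult (\<alpha> j) (Cpoly a q j))" for k
  proof (rule triangular_poly_span)
    show "coeff (Cpoly a q j) j \<noteq> 0" for j
      using coeff_Cpoly(1)[OF q a] Ccoeff_nonzero[OF q a] q by simp
    show "coeff (Cpoly a q j) i = 0" if "i > j" for i j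
      using that by (rule coeff_Cpoly(2)[OF q a])
  qed (auto simp: mon_def)
  have "integrable M (\<lambda>x. x ^ k)" for k
  proof -
    obtain \<alpha> where "mon k = (\<Sum>j<Suc k. smult (\<alpha> j) (Cpoly a q j))" using ex by blast
    from orthogonality_measure_poly(1)[OF M this] show ?thesis
      unfolding mon complex_of_real_integrable_eq .
  qed
  then show "has_all_moments M"
    using M by (auto simp: has_all_moments_def orthogonality_measure_def)
  obtain \<alpha> where \<alpha>: "mon k = (\<Sum>j<Suc k. smult (\<alpha> j) (Cpoly a q j))" using ex by blast
  \<comment> \<open>One expansion serves both measures, as \<open>\<alpha>\<close> does not depend
    on \<open>K\<close>.\<close>
  have "of_real (\<integral>x. x ^ k \<partial>K) = \<alpha> 0 * of_real (measure K UNIV)"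
    if "orthogonality_measure (Ctilde a q) K" for K
    using orthogonality_measure_poly(2)[OF that \<alpha>] unfolding mon integral_complex_of_real .
  from this[OF M] this[OF D]
  have "complex_of_real ((\<integral>x. x ^ k \<partial>M) * measure (discrete_measure a q) UNIV)
      = of_real ((\<integral>x. x ^ k \<partial>discrete_measure a q) * measure M UNIV)"
    by simp
  then show "(\<integral>x. x ^ k \<partial>M) * measure (discrete_measure a q) UNIV
           = (\<integral>x. x ^ k \<partial>discrete_measure a q) * measure M UNIV"
    unfolding of_real_eq_iff .
qed

text \<open>Used with \<open>c = 1\<close> for determinacy and with the ratio of the total masses
  for uniqueness up to a factor.\<close>

lemma discrete_measure_scale_unique:
  assumes N: "has_all_moments N" and c: "c > 0"
    and eq: "\<And>k::nat. (\<integral>x. x ^ k \<partial>N) = c * (\<integral>x. x ^ k \<partial>discrete_measure a q)"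
  shows "N = scale_measure (ennreal c) (discrete_measure a q)"
proof (rule compact_support_moment_determinate[OF _ N])
  show "has_all_moments (scale_measure (ennreal c) (discrete_measure a q))"
    using discrete_measure_has_all_moments c by (rule has_all_moments_scale)
  show "AE x in scale_measure (ennreal c) (discrete_measure a q). \<bar>x\<bar> \<le> sqrt a"
    unfolding scale_measure_eq_density using discrete_measure_AE_bounded by (subst AE_density) auto
  show "(\<integral>x. x ^ k \<partial>N) = (\<integral>x. x ^ k \<partial>scale_measure (ennreal c) (discrete_measure a q))" for k
    using discrete_measure_has_all_moments c
    unfolding eq by (subst integral_scale_measure) (auto simp: has_all_moments_def)
qed (use a in auto)

lemma moment_determinate_discrete_measure: "moment_determinate (discrete_measure a q)"
  unfolding moment_determinate_def
  using discrete_measure_has_all_moments discrete_measure_scale_unique[of _ 1] by auto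

lemma orthogonality_measure_iff:
  "orthogonality_measure (Ctilde a q) M \<longleftrightarrow>
     (\<exists>c>0. M = scale_measure (ennreal c) (discrete_measure a q))"
proof
  assume M: "orthogonality_measure (Ctilde a q) M"
  interpret finite_measure M by (rule orthogonality_measure_finite[OF M])
  \<comment> \<open>The comparison of total masses forces this value.\<close>
  define c where "c = measure M UNIV / measure (discrete_measure a q) UNIV"
  have "measure M UNIV > 0"
    using M by (simp add: orthogonality_measure_def emeasure_eq_measure less_le)
  then have c: "c > 0" using discrete_measure_total_pos by (simp add: c_def)
  have "M = scale_measure (ennreal c) (discrete_measure a q)"
  proof (rule discrete_measure_scale_unique[OF orthogonality_measure_moments(1)[OF M] c])
    show "(\<integral>x. x ^ k \<partial>M) = c * (\<integral>x. x ^ k \<partial>discrete_measure a q)" for k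
      using orthogonality_measure_moments(2)[OF M, of k] discrete_measure_total_pos
      by (simp add: c_def field_simps)
  qed
  with c show "\<exists>c>0. M = scale_measure (ennreal c) (discrete_measure a q)" by blast
next
  assume "\<exists>c>0. M = scale_measure (ennreal c) (discrete_measure a q)"
  then show "orthogonality_measure (Ctilde a q) M"
    using orthogonality_measure_scale[OF discrete_measure_orthogonality] by blast
qed

section \<open>The orthogonality relation as a series\<close>

lemma Ctilde_orthogonality_sums:
  "(\<lambda>s. \<Sum>\<epsilon>\<in>{1, -1}.
       of_real (weight a q s) * Ctilde a q n (of_real (node a q s \<epsilon>))
                              * Ctilde a q n' (of_real (node a q s \<epsilon>)))
     sums of_real (2 * (qpoch_inf (- a * q ^ 3) (q ^ 2) / qpoch_inf q (q ^ 2))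
             * ((1 + a * q) * a ^ n / (1 + a * q ^ (2 * n + 1)))
             * (qpoch q q n / qpoch (- a * q) q n)
             * q powr (real n * (real n + 3) / 2)
             * (if n = n' then 1 else 0))"
proof -
  define p where "p = smult ((- \<i>) ^ (n + n')) (Cpoly a q n * Cpoly a q n')"
  have "(\<Sum>\<epsilon>\<in>{1, -1}. of_real (weight a q s) * Ctilde a q n (of_real (node a q s \<epsilon>))
                              * Ctilde a q n' (of_real (node a q s \<epsilon>)))
      = of_real (weight a q s) * (poly p (xnode a q s) + poly p (- xnode a q s))" for s
    unfolding mult.assoc Ctilde_mult p_def[symmetric] node_eq by (simp add: algebra_simps)
  then have "(\<lambda>s. \<Sum>\<epsilon>\<in>{1, -1}. of_real (weight a q s) * Ctilde a q n (of_real (node a q s \<epsilon>))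
                              * Ctilde a q n' (of_real (node a q s \<epsilon>))) sums qfun a q p"
    using qfun_sums[OF q a, of p] by simp
  also have "qfun a q p = of_real (2 * (qpoch_inf (- a * q ^ 3) (q ^ 2) / qpoch_inf q (q ^ 2))
             * ((1 + a * q) * a ^ n / (1 + a * q ^ (2 * n + 1)))
             * (qpoch q q n / qpoch (- a * q) q n)
             * q powr (real n * (real n + 3) / 2)
             * (if n = n' then 1 else 0))"
  proof (cases "n = n'")
    case False
    then show ?thesis by (simp add: p_def qfun_smult[OF q a] qfun_Cpoly_orthogonal[OF q a])
  next
    case True
    \<comment> \<open>The real exponent is thus a natural number, which lets \<open>powr\<close> be
      replaced by an ordinary power.\<close>
    have "even (n * (n + 3))" by auto
    then have "real n * (real n + 3) / 2 = real (n * (n + 3) div 2)"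
      by (simp add: real_of_nat_div algebra_simps)
    then have powr: "q powr (real n * (real n + 3) / 2) = q ^ (n * (n + 3) div 2)"
      using q powr_realpow by metis
    \<comment> \<open>Supplies exactly the sign carried by the formula for the squared norm.\<close>
    have "(- \<i>) ^ (n + n) = (- 1) ^ n"
      by (simp flip: mult_2 add: power_mult)
    then have "qfun a q p = (- 1) ^ n * qfun a q (Cpoly a q n * Cpoly a q n)"
      using True by (simp add: p_def qfun_smult[OF q a])
    then show ?thesis
      unfolding qfun_Cpoly_square[OF q a] qfun_1[OF q a] powr
      using True qpoch_of_real[of q q n] qpoch_of_real[of "- a * q" q n] by simp
  qed
  finally show ?thesis .
qed

end

theorem mainTheorem1:
  fixes a q :: real
  assumes "0 < q" and "q < 1" and "a > 0"
  shows "(\<forall>n n'. (\<lambda>s. \<Sum>\<epsilon>\<in>{1, -1}.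
             of_real (weight a q s) * Ctilde a q n (of_real (node a q s \<epsilon>))
                                    * Ctilde a q n' (of_real (node a q s \<epsilon>)))
           sums of_real (2 * (qpoch_inf (- a * q ^ 3) (q ^ 2) / qpoch_inf q (q ^ 2))
             * ((1 + a * q) * a ^ n / (1 + a * q ^ (2 * n + 1)))
             * (qpoch q q n / qpoch (- a * q) q n)
             * q powr (real n * (real n + 3) / 2)
             * (if n = n' then 1 else 0)))
    \<and> moment_determinate (discrete_measure a q)
    \<and> (\<forall>M. orthogonality_measure (Ctilde a q) M \<longleftrightarrow>
           (\<exists>c>0. M = scale_measure (ennreal c) (discrete_measure a q)))"
  using Ctilde_orthogonality_sums[OF assms] moment_determinate_discrete_measure[OF assms]
    orthogonality_measure_iff[OF assms] by blast

end
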